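(* Let the game, the communication network, the matrices $Q,\bar Q,\boldsymbol Q,M_\alpha$ and the constants $\bar\mu,\bar\ell,\bar\sigma$ be as described in the context. Let $\alpha>0$ be such that $\rho_\alpha:=\lambda_{\max}(M_\alpha)=\|M_\alpha\|<1$, and let $\alpha^k=\alpha$ for all $k\in\mathbb N$. Consider the algorithm: for every $i\in\mathcal I$, choose $x_i^0\in\Omega_i$, $\boldsymbol x_{i,-i}^0\in\mathbb R^{n-n_i}$, set $\hat q_i^0=e_i^N$, and for $k=0,1,2,\dots$ each agent $i\in\mathcal I$ computes $$\hat{\boldsymbol x}_i^k=\sum_{j\in\mathcal N_i}w_{i,j}\boldsymbol x_j^k,\qquad \hat q_i^{k+1}=\sum_{j\in\mathcal N_i}w_{i,j}\hat q_j^k,$$ $$x_i^{k+1}=\mathrm{proj}_{\Omega_i}\big(\hat{\boldsymbol x}_{i,i}^k-\alpha^k(\hat q_{i,i}^k)^{-1}\nabla_{x_i}J_i(\hat{\boldsymbol x}_i^k)\big),\qquad \boldsymbol x_{i,-i}^{k+1}=\hat{\boldsymbol x}_{i,-i}^k .$$ Then, for any initial condition, the sequence $(\boldsymbol x^k)_{k\in\mathbb N}$ generated by this algorithm converges to $\boldsymbol x^*=\mathbf 1_N\otimes x^*$, where $x^*$ is the (unique) Nash equilibrium of the game, with linear rate: for any $\epsilon>0$ there exists $K>0$ such that, for all $k\in\mathbb N$, $$\|\boldsymbol x^k-\boldsymbol x^*\|_{\boldsymbol Q}\le K(\sqrt{\rho_\alpha}+\epsilon)^{k}\,\|\boldsymbol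 x^0-\boldsymbol x^*\|_{\boldsymbol Q}.$$
   Context: Game. There are $N\ge2$ agents, $\mathcal I=\{1,\dots,N\}$. Agent $i$ chooses $x_i\in\Omega_i\subseteq\mathbb R^{n_i}$; $n=\sum_i n_i$, $x=(x_1,\dots,x_N)\in\mathbb R^n$ (stacked), $x_{-i}$ is the stack of all $x_j$, $j\ne i$, and $\Omega=\Omega_1\times\dots\times\Omega_N$. Agent $i$ has cost $J_i(x_i,x_{-i})$, $J_i:\mathbb R^n\to\mathbb R$. A Nash equilibrium is $x^*\in\Omega$ with $J_i(x_i^*,x_{-i}^* )\le\inf\{J_i(y_i,x_{-i}^* )\mid y_i\in\Omega_i\}$ for all $i$. Assumptions: each $\Omega_i$ is nonempty, closed and convex; each $J_i$ is continuous, and $J_i(\cdot,x_{-i})$ is convex and continuously differentiable for every $x_{-i}$; the pseudo-gradient $F:\mathbb R^n\to\mathbb R^n$, $F(x)=(\nabla_{x_i}J_i(x_i,x_{-i}))_{i\in\mathcal I}$ (stacked), is $\mu$-strongly monotone ($\langle F(x)-F(y),x-y\rangle\ge\mu\|x-y\|^2$ for all $x,y$) and $\ell_0$-Lipschitz for some $\mu,\ell_0>0$. Under these assumptions the Nash equilibrium exists and is unique. Network. Directed graph $\mathcal G(\mathcal I,\mathcal E)$, strongly connected, where $(i,j)\in\mathcal E$ iff agent $i$ can receive information from agent $j$; $\mathcal N_i=\{j\mid(i,j)\in\mathcal E\}$. Its weighted adjacency matrix $W=[w_{i,j}]$ has $w_{i,j}>0$ if $(i,j)\in\mathcal E$, $w_{i,j}=0$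 otherwise, $w_{i,i}>0$ for all $i$, and $W\mathbf 1_N=\mathbf 1_N$. Let $q\in\mathbb R^N_{>0}$ be its left Perron-Frobenius eigenvector: $q^\top W=q^\top$, $\mathbf 1_N^\top q=1$. Set $Q=\mathrm{diag}(q_1,\dots,q_N)$, $\bar Q=\mathrm{diag}(q_1I_{n_1},\dots,q_NI_{n_N})\in\mathbb R^{n\times n}$, $\boldsymbol Q=Q\otimes I_n\in\mathbb R^{Nn\times Nn}$, and $\bar\sigma=\sigma_{N-1}(Q^{1/2}WQ^{-1/2})$, the second largest singular value (counted with multiplicity). Estimates. Agent $i$ keeps $\boldsymbol x_i=(\boldsymbol x_{i,j})_{j\in\mathcal I}\in\mathbb R^n$ with $\boldsymbol x_{i,j}\in\mathbb R^{n_j}$; $\boldsymbol x_{i,i}=x_i$ is its own strategy, $\boldsymbol x_{i,j}$ ($j\neq i$) is its estimate of agent $j$'s strategy, $\boldsymbol x_{i,-i}=(\boldsymbol x_{i,j})_{j\ne i}$, and $\boldsymbol x=(\boldsymbol x_1,\dots,\boldsymbol x_N)\in\mathbb R^{Nn}$. The same block notation is used for $\hat{\boldsymbol x}_i$. $\nabla_{x_i}J_i(\hat{\boldsymbol x}_i)$ is the partial gradient of $J_i$ with respect to its $i$-th block, evaluated at $\hat{\boldsymbol x}_i\in\mathbb R^n$. Agent $i$ also keeps $\hat q_i=(\hat q_{i,j})_{j\in\mathcal I}\in\mathbb R^N$, an estimate of $q$; $e_i^N$ is the $i$-th canonical basis vector of $\mathbb R^N$ (with this initialization $\hat q_{i,i}^k>0$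 for all $k$, so the iteration is well defined). The extended pseudo-gradient is $\boldsymbol F:\mathbb R^{Nn}\to\mathbb R^n$, $\boldsymbol F(\boldsymbol x)=(\nabla_{x_i}J_i(\boldsymbol x_{i,i},\boldsymbol x_{i,-i}))_{i\in\mathcal I}$. Constants. For positive definite $P$, $\langle x,y\rangle_P=x^\top Py$ and $\|x\|_P=\sqrt{x^\top Px}$. $\bar\mu,\bar\ell>0$ are constants such that $\bar F:=\bar Q^{-1}F$ satisfies $\langle\bar F(x)-\bar F(y),x-y\rangle_{\bar Q}\ge\bar\mu\|x-y\|_{\bar Q}^2$ for all $x,y\in\mathbb R^n$, and $\bar{\boldsymbol F}:=\bar Q^{-1}\boldsymbol F$ satisfies $\|\bar{\boldsymbol F}(\boldsymbol x)-\bar{\boldsymbol F}(\boldsymbol y)\|_{\bar Q}\le\bar\ell\|\boldsymbol x-\boldsymbol y\|_{\boldsymbol Q}$ for all $\boldsymbol x,\boldsymbol y\in\mathbb R^{Nn}$ (such constants exist under the assumptions above). Finally $$M_\alpha=\begin{bmatrix}1-2\alpha\bar\mu\lambda_{\min}(Q)+\alpha^2\bar\ell^2 & 2\alpha\bar\ell\bar\sigma\\ 2\alpha\bar\ell\bar\sigma & (1+2\alpha\bar\ell+\alpha^2\bar\ell^2)\bar\sigma^2\end{bmatrix},$$ where $\lambda_{\min},\lambda_{\max}$ denote smallest and largest eigenvalues of a symmetric matrix. $\mathrm{proj}_{S}$ is the Euclidean projection onto the closed convex set $S$; $\otimes$ is the Kronecker product; $\mathbf 1_N$ is the all-ones vector.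 *)

theory Defs
  imports "HOL-Analysis.Analysis"
begin

section \<open>Matrices and spectra\<close>

definition diag_matrix :: "('n::finite \<Rightarrow> real) \<Rightarrow> real^'n^'n" where
  "diag_matrix d = (\<chi> i j. if i = j then d i else 0)"

definition kron_matrix ::
    "real^'m^'m \<Rightarrow> real^'n^'n \<Rightarrow> real^('m::finite \<times> 'n::finite)^('m \<times> 'n)" where
  "kron_matrix A B = (\<chi> r s. A $ fst r $ fst s * B $ snd r $ snd s)"

definition kron_vector :: "real^'m \<Rightarrow> real^'n \<Rightarrow> real^('m::finite \<times> 'n::finite)" where
  "kron_vector u v = (\<chi> r. u $ fst r * v $ snd r)"

definition inner_wrt :: "real^'n^'n \<Rightarrow> real^'n \<Rightarrow> real^'n::finite \<Rightarrow> real" where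
  "inner_wrt P x y = x \<bullet> (P *v y)"

definition norm_wrt :: "real^'n^'n \<Rightarrow> real^'n::finite \<Rightarrow> real" where
  "norm_wrt P x = sqrt (x \<bullet> (P *v x))"

definition eigenvalues :: "real^'n^'n \<Rightarrow> real set" where
  "eigenvalues A = {t. \<exists>v::real^'n::finite. v \<noteq> 0 \<and> A *v v = t *\<^sub>R v}"

definition lambda_min :: "real^'n^'n::finite \<Rightarrow> real" where
  "lambda_min A = Min (eigenvalues A)"

definition lambda_max :: "real^'n^'n::finite \<Rightarrow> real" where
  "lambda_max A = Max (eigenvalues A)"

text \<open>Square roots of the eigenvalues of the symmetric matrix \<open>A\<^sup>T A\<close>, each repeated as often
  as its multiplicity. By symmetry geometric and algebraic multiplicity agree.\<close>

definition singular_values :: "real^'n^'n \<Rightarrow> real multiset" where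
  "singular_values A =
     (\<Sum>t \<in> eigenvalues (transpose A ** A).
        replicate_mset (dim {v::real^'n::finite. (transpose A ** A) *v v = t *\<^sub>R v}) (sqrt t))"

text \<open>Singular values are numbered from 1 in increasing order, so that for an \<open>N \<times> N\<close> matrix
  index \<open>N\<close> is the largest and index \<open>N - 1\<close> the second largest one.\<close>

definition singular_value :: "nat \<Rightarrow> real^'n^'n::finite \<Rightarrow> real" where
  "singular_value k A = sorted_list_of_multiset (singular_values A) ! (k - 1)"


section \<open>Games\<close>

text \<open>Agents are the elements of a finite type \<open>'i\<close>, the \<open>n\<close> scalar coordinates of the joint
  strategy those of a finite type \<open>'c\<close>. The map \<open>own\<close> assigns to each coordinate the agent whose
  block contains it, so the blocks may have different sizes \<open>n\<^sub>i = card {c. own c = i}\<close>. The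
  space \<open>\<real>\<^bsup>n\<^sub>i\<^esup>\<close> is identified, isometrically, with the vectors of \<open>\<real>\<^sup>n\<close> that vanish off block \<open>i\<close>.\<close>

definition block_space :: "('c \<Rightarrow> 'i) \<Rightarrow> 'i \<Rightarrow> (real^'c::finite) set" where
  "block_space own i = {v. \<forall>c. own c \<noteq> i \<longrightarrow> v $ c = 0}"

definition block :: "('c \<Rightarrow> 'i) \<Rightarrow> 'i \<Rightarrow> real^'c \<Rightarrow> real^'c::finite" where
  "block own i x = (\<chi> c. if own c = i then x $ c else 0)"

text \<open>The joint strategy \<open>(y\<^sub>i, x\<^bsub>-i\<^esub>)\<close>.\<close>

definition replace_block :: "('c \<Rightarrow> 'i) \<Rightarrow> 'i \<Rightarrow> real^'c \<Rightarrow> real^'c \<Rightarrow> real^'c::finite" where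
  "replace_block own i y x = (\<chi> c. if own c = i then y $ c else x $ c)"

definition gradient :: "('a::real_inner \<Rightarrow> real) \<Rightarrow> 'a \<Rightarrow> 'a" where
  "gradient f x = (THE g. GDERIV f x :> g)"

definition cont_differentiable :: "('a::real_inner \<Rightarrow> real) \<Rightarrow> bool" where
  "cont_differentiable f \<longleftrightarrow> (\<forall>x. \<exists>g. GDERIV f x :> g) \<and> continuous_on UNIV (gradient f)"

text \<open>\<open>\<nabla>\<^bsub>x\<^sub>i\<^esub> J\<^sub>i\<close> at \<open>x\<close>. The differentiated function depends on block \<open>i\<close> of its argument only,
  hence its gradient lies in \<open>block_space own i\<close>.\<close>

definition partial_grad ::
    "('c \<Rightarrow> 'i) \<Rightarrow> ('i \<Rightarrow> real^'c \<Rightarrow> real) \<Rightarrow> 'i \<Rightarrow> real^'c \<Rightarrow> real^'c::finite" where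
  "partial_grad own J i x = gradient (\<lambda>y. J i (replace_block own i y x)) x"

definition pseudo_grad ::
    "('c \<Rightarrow> 'i) \<Rightarrow> ('i \<Rightarrow> real^'c \<Rightarrow> real) \<Rightarrow> real^'c \<Rightarrow> real^'c::finite" where
  "pseudo_grad own J x = (\<chi> c. partial_grad own J (own c) x $ c)"

definition joint_set :: "('c \<Rightarrow> 'i) \<Rightarrow> ('i \<Rightarrow> (real^'c) set) \<Rightarrow> (real^'c::finite) set" where
  "joint_set own \<Omega> = {x. \<forall>i. block own i x \<in> \<Omega> i}"

text \<open>The infimum is taken in the extended reals, as it may be \<open>-\<infinity>\<close>.\<close>

definition nash_equilibrium ::
    "('c \<Rightarrow> 'i) \<Rightarrow> ('i \<Rightarrow> (real^'c) set) \<Rightarrow> ('i \<Rightarrow> real^'c \<Rightarrow> real) \<Rightarrow> real^'c::finite \<Rightarrow> bool" where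
  "nash_equilibrium own \<Omega> J x \<longleftrightarrow>
     x \<in> joint_set own \<Omega> \<and>
     (\<forall>i. ereal (J i x) \<le> (INF y\<in>\<Omega> i. ereal (J i (replace_block own i y x))))"


section \<open>Estimates and the algorithm\<close>

text \<open>The stack of all agents' estimates lives in \<open>\<real>\<^bsup>Nn\<^esup>\<close>, indexed by \<open>'i \<times> 'c\<close>; \<open>estimate x i\<close>
  is agent \<open>i\<close>'s estimate of the joint strategy, whose block \<open>i\<close> is the agent's own strategy.\<close>

definition estimate :: "real^('i \<times> 'c) \<Rightarrow> 'i::finite \<Rightarrow> real^'c::finite" where
  "estimate x i = (\<chi> c. x $ (i, c))"

definition ext_pseudo_grad ::
    "('c \<Rightarrow> 'i) \<Rightarrow> ('i \<Rightarrow> real^'c \<Rightarrow> real) \<Rightarrow> real^('i::finite \<times> 'c) \<Rightarrow> real^'c::finite" where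
  "ext_pseudo_grad own J x = (\<chi> c. partial_grad own J (own c) (estimate x (own c)) $ c)"

definition mixed_estimate ::
    "('i \<times> 'i) set \<Rightarrow> real^'i^'i \<Rightarrow> real^('i \<times> 'c) \<Rightarrow> 'i::finite \<Rightarrow> real^'c::finite" where
  "mixed_estimate E W x i = (\<Sum>j\<in>{j. (i, j) \<in> E}. W $ i $ j *\<^sub>R estimate x j)"

text \<open>\<open>x k\<close> is the stack of the estimates and \<open>qh k i\<close> agent \<open>i\<close>'s estimate of the left
  Perron-Frobenius eigenvector at time \<open>k\<close>; \<open>a k\<close> is the step size.\<close>

definition generated_by_algorithm ::
    "('c::finite \<Rightarrow> 'i) \<Rightarrow> ('i \<Rightarrow> (real^'c) set) \<Rightarrow> ('i \<Rightarrow> real^'c \<Rightarrow> real) \<Rightarrow>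
     ('i \<times> 'i) set \<Rightarrow> real^'i^'i \<Rightarrow> (nat \<Rightarrow> real) \<Rightarrow>
     (nat \<Rightarrow> real^('i \<times> 'c)) \<Rightarrow> (nat \<Rightarrow> 'i::finite \<Rightarrow> real^'i) \<Rightarrow> bool" where
  "generated_by_algorithm own \<Omega> J E W a x qh \<longleftrightarrow>
     (\<forall>i. block own i (estimate (x 0) i) \<in> \<Omega> i) \<and>
     (\<forall>i. qh 0 i = axis i 1) \<and>
     (\<forall>k i. qh (Suc k) i = (\<Sum>j\<in>{j. (i, j) \<in> E}. W $ i $ j *\<^sub>R qh k j)) \<and>
     (\<forall>k i. block own i (estimate (x (Suc k)) i) =
        closest_point (\<Omega> i)
          (block own i (mixed_estimate E W (x k) i)
            - (a k * inverse (qh k i $ i)) *\<^sub>R partial_grad own J i (mixed_estimate E W (x k) i))) \<and>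
     (\<forall>k i j. j \<noteq> i \<longrightarrow>
        block own j (estimate (x (Suc k)) i) = block own j (mixed_estimate E W (x k) i))"

text \<open>The contraction matrix \<open>M\<^sub>\<alpha>\<close>; the arguments \<open>m\<close>, \<open>l\<close>, \<open>s\<close>, \<open>c\<close> are
  \<open>\<mu>\<close>-bar, \<open>\<ell>\<close>-bar, \<open>\<sigma>\<close>-bar and \<open>\<lambda>\<^bsub>min\<^esub>(Q)\<close>.\<close>

definition contraction_matrix :: "real \<Rightarrow> real \<Rightarrow> real \<Rightarrow> real \<Rightarrow> real \<Rightarrow> real^2^2" where
  "contraction_matrix \<alpha> m l s c =
     vector [vector [1 - 2 * \<alpha> * m * c + \<alpha>^2 * l^2, 2 * \<alpha> * l * s],
             vector [2 * \<alpha> * l * s, (1 + 2 * \<alpha> * l + \<alpha>^2 * l^2) * s^2]]"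

end

(*
  Let d be the difference of the stacked estimates and the stacked equilibrium, u its q-weighted
  average over the agents (repeated N times) and p = d - u. In the norm weighted by q, mixing with W
  fixes u and shrinks p by the second singular value sigma, since sqrt q is the top right singular
  vector of Q^(1/2) W Q^(-1/2). If the estimates of q were exact, the projected gradient step would
  bound the new squared distance by the quadratic form of M_alpha at (|u|, |p|): strong monotonicity
  controls the part of the gradient along the consensus direction and the Lipschitz bound all other
  terms. Hence the distance contracts by sqrt rho. The equilibrium is a fixed point for every choice
  of the positive weights, so replacing q by its estimate perturbs the contraction factor only by
  e_k = sum_i |q_i / qhat_i^k - 1| up to a constant. The lower right entry of M_alpha is at most
  rho < 1, which forces sigma < 1; then the powers of W converge to 1 q^T, so e_k tends to 0 and no
  Perron-Frobenius theory is needed.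
*)

theory Submission
  imports Defs
begin

subsection \<open>Spectra of symmetric matrices\<close>

text \<open>\<open>W\<close> is only row stochastic, so mixing need not contract disagreement in the
  Euclidean norm. With weights q the orthogonal projection onto consensus is the q-average, which
  \<open>W\<close> preserves. The price is that the weighted inner product multiplies the gradient
  of agent i by \<open>q $ i\<close>; dividing each gradient by \<open>q $ i\<close> cancels this
  factor, so that on consensus vectors the monotonicity of the plain pseudo-gradient is recovered. A
  stack repeating a has weighted norm |a|, whereas monotonicity is measured with every block
  weighted by its owner's q; comparing the two norms brings in the smallest eigenvalue of Q. The
  second singular value is an entry of a sorted list with multiplicities. Bounding it from below
  means exhibiting two large entries in a list of known length, and for this the spectral theorem
  with dimensions of eigenspaces is developed. The \<epsilon> in the rate is what a perturbation
  that merely tends to 0 costs: it is eventually below \<epsilon>, and K pays for the finitely many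
  steps before that.\<close>

lemma quadratic_nonneg_imp_linear_zero:
  fixes a b :: real
  assumes "\<And>t. 0 \<le> 2 * t * b + t^2 * a"
  shows "b = 0"
proof (rule ccontr)
  assume b: "b \<noteq> 0"
  show False
  proof (cases "a \<le> 0")
    case True
    then have "b * b * a \<le> 0" by (simp add: mult_nonneg_nonpos)
    moreover have "0 \<le> - 2 * (b * b) + b * b * a" using assms[of "-b"] by (simp add: power2_eq_square)
    ultimately have "b * b \<le> 0" by linarith
    then show False using b by (metis mult_eq_0_iff order_antisym zero_le_square)
  next
    case False
    have "2 * (-b/a) * b + (-b/a)^2 * a = - (b^2/a)"
      using False by (simp add: field_simps power2_eq_square)
    then have "b^2/a \<le> 0" using assms[of "-b/a"] by simp
    then show False using False b by (simp add: divide_le_0_iff)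
  qed
qed

text \<open>A maximiser of \<open>x \<bullet> f x\<close> on the unit sphere of the subspace is an eigenvector.\<close>

lemma selfadjoint_top_eigenvector:
  fixes f :: "'a::euclidean_space \<Rightarrow> 'a"
  assumes f: "linear f" and sym: "\<And>x y. f x \<bullet> y = x \<bullet> f y"
    and S: "subspace S" "S \<noteq> {0}" and inv: "f ` S \<subseteq> S"
  obtains v t where "v \<in> S" "norm v = 1" "f v = t *\<^sub>R v" "\<And>x. x \<in> S \<Longrightarrow> x \<bullet> f x \<le> t * (x \<bullet> x)"
proof -
  interpret linear f by fact
  let ?K = "sphere 0 1 \<inter> S"
  have K: "compact ?K"
    by (intro compact_Int_closed closed_subspace S) auto
  obtain w where w: "w \<in> S" "w \<noteq> 0" using S subspace_0 by fastforce
  then have "(1 / norm w) *\<^sub>R w \<in> ?K" using S by (auto simp: subspace_scale)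
  then have "?K \<noteq> {}" by blast
  moreover have "continuous_on ?K (\<lambda>x. x \<bullet> f x)"
    by (intro continuous_intros linear_continuous_on f linear_conv_bounded_linear[THEN iffD1])
  ultimately obtain v where v: "v \<in> ?K" "\<And>x. x \<in> ?K \<Longrightarrow> x \<bullet> f x \<le> v \<bullet> f v"
    using continuous_attains_sup[OF K] by metis
  define t where "t = v \<bullet> f v"
  have vS: "v \<in> S" "v \<bullet> v = 1" using v by (auto simp: dot_square_norm)
  have le: "x \<bullet> f x \<le> t * (x \<bullet> x)" if "x \<in> S" for x
  proof (cases "x = 0")
    case True then show ?thesis by simp
  next
    case False
    have "(1 / norm x) *\<^sub>R x \<in> ?K" using False that S by (auto simp: subspace_scale)
    from v(2)[OF this] have "(x \<bullet> f x) / (norm x * norm x) \<le> t" by (simp add: t_def scaleR)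
    then show ?thesis using False by (simp add: field_simps dot_square_norm power2_eq_square)
  qed
  have "t *\<^sub>R v - f v = 0"
  proof -
    let ?g = "t *\<^sub>R v - f v"
    have gS: "?g \<in> S" using vS inv S by (auto simp: subspace_scale subspace_diff)
    \<comment> \<open>The function \<open>t * (x \<bullet> x) - x \<bullet> f x\<close> is
      nonnegative on \<open>S\<close> and vanishes at \<open>v\<close>. Along the line through
      \<open>v\<close> in the direction of the residual \<open>?g\<close> its linear coefficient is
      \<open>2 * (?g \<bullet> ?g)\<close>, which must therefore be 0.\<close>
    have "0 \<le> 2 * s * (?g \<bullet> ?g) + s^2 * (t * (?g \<bullet> ?g) - ?g \<bullet> f ?g)" for s
    proof -
      have "v + s *\<^sub>R ?g \<in> S" using vS gS S by (simp add: subspace_add subspace_scale)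
      from le[OF this]
      have "0 \<le> t * ((v + s *\<^sub>R ?g) \<bullet> (v + s *\<^sub>R ?g)) - (v + s *\<^sub>R ?g) \<bullet> f (v + s *\<^sub>R ?g)" by simp
      also have "\<dots> = t * (v \<bullet> v) - v \<bullet> f v + 2 * s * (t * (v \<bullet> ?g) - ?g \<bullet> f v)
          + s^2 * (t * (?g \<bullet> ?g) - ?g \<bullet> f ?g)"
        using sym[of ?g v]
        by (simp only: add scaleR inner_add_left inner_add_right inner_scaleR_left inner_scaleR_right
             inner_commute[of "f _"] inner_commute[of ?g v] sym[symmetric, of v ?g])
           (simp add: algebra_simps power2_eq_square inner_commute)
      also have "t * (v \<bullet> ?g) - ?g \<bullet> f v = ?g \<bullet> ?g"
        by (simp add: inner_diff_left inner_diff_right inner_commute algebra_simps)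
      finally show ?thesis using vS by (simp add: t_def)
    qed
    then have "?g \<bullet> ?g = 0" by (rule quadratic_nonneg_imp_linear_zero)
    then show ?thesis by simp
  qed
  then show thesis using that[of v t] vS le v by (auto simp: dot_square_norm)
qed

section \<open>Spectral decomposition of a symmetric matrix\<close>

context
  fixes A :: "real^'n^'n::finite"
  assumes sym: "transpose A = A"
begin

lemma symmetric_inner: "(A *v x) \<bullet> y = x \<bullet> (A *v y)"
  by (metis sym dot_lmul_matrix vector_transpose_matrix)

definition "eigenspace t = {v. A *v v = t *\<^sub>R v}"

lemma eigenspace_subspace: "subspace (eigenspace t)"
  by (auto simp: subspace_def eigenspace_def matrix_vector_right_distrib scaleR_right_distrib
      matrix_vector_mult_scaleR mult.commute)

lemma eigenspaces_orthogonal: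
  assumes "v \<in> eigenspace s" "w \<in> eigenspace t" "s \<noteq> t" shows "v \<bullet> w = 0"
proof -
  have "s * (v \<bullet> w) = t * (v \<bullet> w)"
    using symmetric_inner[of v w] assms by (simp add: eigenspace_def)
  then show ?thesis using assms by simp
qed

text \<open>Chosen for every real \<open>t\<close> at once. If \<open>t\<close> is not an eigenvalue
  the basis is empty, so unions may range over all reals.\<close>

definition "eigenbasis t = (SOME B. 0 \<notin> B \<and> B \<subseteq> eigenspace t \<and> pairwise orthogonal B \<and>
   card B = dim (eigenspace t) \<and> span B = eigenspace t)"

lemma eigenbasis:
  "0 \<notin> eigenbasis t" "eigenbasis t \<subseteq> eigenspace t" "pairwise orthogonal (eigenbasis t)"
  "card (eigenbasis t) = dim (eigenspace t)" "span (eigenbasis t) = eigenspace t"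
proof -
  have "\<exists>B. 0 \<notin> B \<and> B \<subseteq> eigenspace t \<and> pairwise orthogonal B \<and>
     card B = dim (eigenspace t) \<and> span B = eigenspace t"
    using orthogonal_basis_subspace[OF eigenspace_subspace] by metis
  from someI_ex[OF this] show
    "0 \<notin> eigenbasis t" "eigenbasis t \<subseteq> eigenspace t" "pairwise orthogonal (eigenbasis t)"
    "card (eigenbasis t) = dim (eigenspace t)" "span (eigenbasis t) = eigenspace t"
    unfolding eigenbasis_def by auto
qed

lemma eigenvalues_iff: "t \<in> eigenvalues A \<longleftrightarrow> eigenspace t \<noteq> {0}"
proof -
  have "0 \<in> eigenspace t" by (rule subspace_0[OF eigenspace_subspace])
  then show ?thesis by (auto simp: eigenvalues_def eigenspace_def)
qed

lemma eigenvalue_dim_pos: "t \<in> eigenvalues A \<Longrightarrow> 0 < dim (eigenspace t)"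
  using eigenvalues_iff[of t] dim_eq_0[of "eigenspace t"] subspace_0[OF eigenspace_subspace, of t]
  by (cases "dim (eigenspace t) = 0") auto

lemma eigenbases_independent: "independent (\<Union>t. eigenbasis t)"
proof (rule pairwise_orthogonal_independent)
  show "pairwise orthogonal (\<Union>t. eigenbasis t)"
    unfolding pairwise_def orthogonal_def
  proof (intro ballI impI)
    fix v w assume v: "v \<in> (\<Union>t. eigenbasis t)" and w: "w \<in> (\<Union>t. eigenbasis t)" and "v \<noteq> w"
    then obtain s t where "v \<in> eigenbasis s" "w \<in> eigenbasis t" by blast
    then show "v \<bullet> w = 0"
      using eigenbasis(2,3) eigenspaces_orthogonal[of v s w t] \<open>v \<noteq> w\<close>
      unfolding pairwise_def orthogonal_def by (cases "s = t") blast+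
  qed
qed (use eigenbasis(1) in blast)

text \<open>Otherwise the orthogonal complement of the span is nonzero and invariant under
  \<open>A\<close>, so \<open>selfadjoint_top_eigenvector\<close> finds an eigenvector in it. This
  vector also lies in the span and is orthogonal to itself.\<close>

lemma eigenbases_span: "span (\<Union>t. eigenbasis t) = UNIV"
proof (rule ccontr)
  let ?U = "span (\<Union>t. eigenbasis t)"
  let ?P = "{y. \<forall>x \<in> ?U. orthogonal x y}"
  assume "?U \<noteq> UNIV"
  then obtain a where a: "a \<noteq> 0" "\<And>x. x \<in> ?U \<Longrightarrow> orthogonal a x"
    using orthogonal_to_subspace_exists_gen[of ?U UNIV] by (auto simp: span_span psubset_eq)
  have P: "subspace ?P" by (rule subspace_orthogonal_to_vectors)
  have es: "eigenspace t \<subseteq> ?U" for t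
    using eigenbasis(5)[of t] span_mono[of "eigenbasis t" "\<Union>t. eigenbasis t"] by blast
  have AU: "A *v x \<in> ?U" if "x \<in> ?U" for x
    using that
  proof (induction rule: span_induct_alt)
    case base then show ?case by (simp add: span_0)
  next
    case (step c x y)
    then obtain t where "x \<in> eigenspace t" using eigenbasis(2) by blast
    then have "A *v x \<in> ?U" using es[of t] by (auto simp: eigenspace_def span_scale)
    then show ?case using step
      by (simp add: matrix_vector_right_distrib matrix_vector_mult_scaleR span_add span_scale)
  qed
  have PA: "(*v) A ` ?P \<subseteq> ?P"
    using AU by (auto simp: orthogonal_def symmetric_inner[symmetric])
  have "a \<in> ?P" using a(2) by (simp add: orthogonal_commute)
  then have P0: "?P \<noteq> {0}" using a(1) by blast
  obtain v t where v: "v \<in> ?P" "norm v = 1" "A *v v = t *\<^sub>R v"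
    by (rule selfadjoint_top_eigenvector[OF matrix_vector_mul_linear[of A] symmetric_inner P P0 PA])
      (rule that)
  then have "v \<in> ?U" using es[of t] by (auto simp: eigenspace_def)
  then have "v \<bullet> v = 0" using v(1) by (auto simp: orthogonal_def)
  then show False using v(2) by simp
qed

lemma finite_eigenbases: "finite (\<Union>t. eigenbasis t)"
  using eigenbases_independent independent_imp_finite by blast

lemma finite_eigenvalues: "finite (eigenvalues A)"
proof -
  define b where "b t = (SOME v. v \<in> eigenbasis t)" for t
  have b: "b t \<in> eigenbasis t" if "t \<in> eigenvalues A" for t
  proof -
    have "eigenbasis t \<noteq> {}"
      using eigenvalue_dim_pos[OF that] eigenbasis(4)[of t] by (metis card.empty less_numeral_extra(3))
    then show ?thesis unfolding b_def by (simp add: some_in_eq)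
  qed
  have "inj_on b (eigenvalues A)"
  proof (rule inj_onI, rule ccontr)
    fix s t assume *: "s \<in> eigenvalues A" "t \<in> eigenvalues A" "b s = b t" "s \<noteq> t"
    then have "b s \<bullet> b s = 0"
      using eigenspaces_orthogonal[of "b s" s "b t" t] b eigenbasis(2) by (metis subsetD)
    then show False using b[OF *(1)] eigenbasis(1) by auto
  qed
  moreover have "b ` eigenvalues A \<subseteq> (\<Union>t. eigenbasis t)" using b by blast
  ultimately show ?thesis using finite_eigenbases by (metis finite_imageD finite_subset)
qed

text \<open>Applied to the matrix \<open>transpose A ** A\<close>, this fixes the length of the list
  of singular values of \<open>A\<close>, and hence which entry the index
  \<open>CARD('n) - 1\<close> selects.\<close>

lemma sum_eigenspace_dims: "(\<Sum>t\<in>eigenvalues A. dim (eigenspace t)) = CARD('n)"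
proof -
  have empty: "eigenbasis t = {}" if "t \<notin> eigenvalues A" for t
    using that eigenvalues_iff[of t] eigenbasis(1,2)[of t] by auto
  have U: "(\<Union>t. eigenbasis t) = (\<Union>t\<in>eigenvalues A. eigenbasis t)"
    using empty by blast
  have "(\<Sum>t\<in>eigenvalues A. dim (eigenspace t)) = (\<Sum>t\<in>eigenvalues A. card (eigenbasis t))"
    by (simp add: eigenbasis(4))
  also have "\<dots> = card (\<Union>t\<in>eigenvalues A. eigenbasis t)"
  proof (rule card_UN_disjoint[symmetric])
    show "\<forall>i\<in>eigenvalues A. finite (eigenbasis i)" using finite_eigenbases
      by (meson UN_upper UNIV_I finite_subset)
    show "\<forall>i\<in>eigenvalues A. \<forall>j\<in>eigenvalues A. i \<noteq> j \<longrightarrow> eigenbasis i \<inter> eigenbasis j = {}"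
    proof (intro ballI impI, rule ccontr)
      fix i j assume "i \<noteq> j" "eigenbasis i \<inter> eigenbasis j \<noteq> {}"
      then obtain v where "v \<in> eigenbasis i" "v \<in> eigenbasis j" by blast
      then have "v \<bullet> v = 0" "v \<noteq> 0"
        using eigenspaces_orthogonal[of v i v j] \<open>i \<noteq> j\<close> eigenbasis(1,2) by (metis subsetD)+
      then show False by simp
    qed
  qed (rule finite_eigenvalues)
  also have "\<dots> = dim (UNIV :: (real^'n) set)"
    using dim_eq_card[OF _ eigenbases_independent, of UNIV] eigenbases_span U by (simp add: span_UNIV)
  finally show ?thesis by simp
qed

lemma eigenvalues_nonempty: "eigenvalues A \<noteq> {}"
  using sum_eigenspace_dims by fastforce

lemma lambda_max_eigenvalue: "lambda_max A \<in> eigenvalues A"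
  unfolding lambda_max_def using finite_eigenvalues eigenvalues_nonempty by (rule Max_in)

lemma lambda_max_ge: "x \<bullet> (A *v x) \<le> lambda_max A * (x \<bullet> x)"
proof -
  have "UNIV \<noteq> {0 :: real^'n}" by (metis UNIV_I singletonD axis_eq_0_iff zero_neq_one)
  then obtain v t where v: "norm v = 1" "A *v v = t *\<^sub>R v" "\<And>x. x \<bullet> (A *v x) \<le> t * (x \<bullet> x)"
    using selfadjoint_top_eigenvector[OF matrix_vector_mul_linear[of A] symmetric_inner subspace_UNIV]
    by (metis UNIV_I subset_UNIV)
  then have "v \<noteq> 0" by auto
  with v have "t \<in> eigenvalues A" unfolding eigenvalues_def by blast
  then have "t \<le> lambda_max A" unfolding lambda_max_def using finite_eigenvalues by simp
  then show ?thesis using v(3)[of x] by (meson inner_ge_zero mult_right_mono order_trans)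
qed

end

section \<open>The second largest singular value\<close>

lemma sorted_list_of_multiset_second_largest:
  fixes M :: "real multiset"
  assumes "size (filter_mset (\<lambda>y. s \<le> y) M) \<ge> 2"
  shows "s \<le> sorted_list_of_multiset M ! (size M - 2)"
proof (rule ccontr)
  define xs where "xs = sorted_list_of_multiset M"
  assume "\<not> ?thesis"
  then have lt: "xs ! (size M - 2) < s" by (simp add: xs_def)
  have M: "mset xs = M" "sorted xs" "length xs = size M"
    by (auto simp: xs_def simp flip: size_mset)
  have "size (filter_mset (\<lambda>y. s \<le> y) M) \<le> size M" by (rule size_filter_mset_lesseq)
  with assms have len: "length xs \<ge> 2" using M(3) by linarith
  \<comment> \<open>The list increases and is indexed from 0, so position \<open>size M - 2\<close>
    holds the second largest entry. If that entry is below \<open>s\<close>, only the last one can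
    reach \<open>s\<close>.\<close>
  have small: "xs ! i < s" if "i \<le> length xs - 2" for i
    using sorted_nth_mono[OF M(2) that] lt len M by auto
  have "filter (\<lambda>y. s \<le> y) (butlast xs) = []"
  proof -
    have "y < s" if "y \<in> set (butlast xs)" for y
    proof -
      have "\<exists>i. i < length xs - 1 \<and> y = xs ! i"
        using that in_set_conv_nth[of y "butlast xs"] nth_butlast[of _ xs] by auto
      then obtain i where "i < length xs - 1" "y = xs ! i" by blast
      then show ?thesis using small[of i] len by simp
    qed
    then show ?thesis by (auto simp: filter_empty_conv not_le)
  qed
  moreover have "xs = butlast xs @ [last xs]" using len by (metis append_butlast_last_id list.size(3) not_numeral_le_zero)
  ultimately have "length (filter (\<lambda>y. s \<le> y) xs) \<le> 1"
    by (metis append_self_conv2 filter_append length_filter_le length_Cons list.size(3) One_nat_def)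
  moreover have "size (filter_mset (\<lambda>y. s \<le> y) M) = length (filter (\<lambda>y. s \<le> y) xs)"
    by (metis M(1) mset_filter size_mset)
  ultimately show False using assms by simp
qed

lemma filter_replicate_mset:
  "filter_mset P (replicate_mset n a) = (if P a then replicate_mset n a else {#})"
  by (induction n) auto

text \<open>On the complement of \<open>u\<close> the quotient of |A x|^2 and |x|^2 is at most its
  maximum \<open>t\<close>, attained at an eigenvector \<open>w\<close> of
  \<open>transpose A ** A\<close>. It remains to see that \<open>sqrt t\<close> does not exceed the
  second largest entry: \<open>u\<close> accounts for an entry 1, at least \<open>sqrt t\<close> by
  nonexpansiveness, and \<open>w\<close> for the entry \<open>sqrt t\<close>.\<close>

lemma second_singular_value_bound:
  fixes A :: "real^'n^'n::finite" and u v :: "real^'n"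
  assumes card: "CARD('n) \<ge> 2" and nonexp: "\<And>x. norm (A *v x) \<le> norm x"
    and u: "u \<noteq> 0" "(transpose A ** A) *v u = u" and v: "u \<bullet> v = 0"
  shows "norm (A *v v) \<le> singular_value (CARD('n) - 1) A * norm v"
    and "0 \<le> singular_value (CARD('n) - 1) A"
proof -
  define B where "B = transpose A ** A"
  have sym: "transpose B = B" by (simp add: B_def matrix_transpose_mul transpose_transpose)
  note es = eigenspace_def[OF sym]
  have B: "x \<bullet> (B *v x) = (norm (A *v x))\<^sup>2" for x
    by (simp add: B_def power2_norm_eq_inner flip: matrix_vector_mul_assoc)
       (metis dot_lmul_matrix inner_commute vector_transpose_matrix transpose_transpose)
  define S where "S = {y. u \<bullet> y = 0}"
  have S: "subspace S" by (auto simp: S_def subspace_def inner_add_right)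
  have inv: "(*v) B ` S \<subseteq> S"
    using u symmetric_inner[OF sym, of u] by (auto simp: S_def B_def)
  have ne: "S \<noteq> {0}"
  proof
    assume "S = {0}"
    obtain x where x: "x \<noteq> 0" "orthogonal u x"
      using orthogonal_to_vector_exists[of u] card by auto
    then have "x \<in> S" by (simp add: S_def orthogonal_def)
    with \<open>S = {0}\<close> x(1) show False by blast
  qed
  obtain w t where w: "w \<in> S" "norm w = 1" "B *v w = t *\<^sub>R w" "\<And>x. x \<in> S \<Longrightarrow> x \<bullet> (B *v x) \<le> t * (x \<bullet> x)"
    by (rule selfadjoint_top_eigenvector[OF matrix_vector_mul_linear[of B] symmetric_inner[OF sym]
          S ne inv]) (rule that)
  have t: "t = (norm (A *v w))\<^sup>2" using B[of w] w(2,3) by (simp add: dot_square_norm)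
  then have t01: "0 \<le> t" "t \<le> 1" using nonexp[of w] w(2) by (simp_all add: power_le_one)
  have uw: "u \<bullet> w = 0" "w \<bullet> u = 0" using w(1) by (auto simp: S_def inner_commute[of w u])
  have u2: "B *v u = u" using u(2) by (simp add: B_def)
  have w0: "w \<noteq> 0" using w(2) by auto
  have tev: "t \<in> eigenvalues B" and oev: "1 \<in> eigenvalues B"
    using w(3) w0 u unfolding eigenvalues_def B_def by auto
  note fin = finite_eigenvalues[OF sym]
  define M where "M = singular_values A"
  have M: "M = (\<Sum>t\<in>eigenvalues B. replicate_mset (dim (eigenspace B t)) (sqrt t))"
    by (simp add: M_def singular_values_def B_def[symmetric] es)
  have size: "size M = CARD('n)"
    unfolding M using sum_eigenspace_dims[OF sym] by simp
  \<comment> \<open>For \<open>t = 1\<close> the two entries come from the same eigenspace, whose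
    dimension is then at least 2; otherwise they come from two distinct summands.\<close>
  have two: "size (filter_mset (\<lambda>y. sqrt t \<le> y) M) \<ge> 2"
  proof (cases "t = 1")
    case True
    have "independent {u, w}"
      using u(1) w0 uw by (intro pairwise_orthogonal_independent) (auto simp: pairwise_def orthogonal_def)
    moreover have "u \<noteq> w" using uw u(1) by auto
    moreover have "{u, w} \<subseteq> eigenspace B 1" using u2 w(3) True by (auto simp: es)
    ultimately have "2 \<le> dim (eigenspace B 1)"
      using independent_card_le_dim[of "{u,w}" "eigenspace B 1"] by (simp del: insert_subset)
    moreover have "M = replicate_mset (dim (eigenspace B 1)) (sqrt 1)
      + (\<Sum>t\<in>eigenvalues B - {1}. replicate_mset (dim (eigenspace B t)) (sqrt t))"
      unfolding M by (rule sum.remove[OF fin oev])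
    ultimately show ?thesis using True by (simp add: filter_replicate_mset)
  next
    case False
    have "M = replicate_mset (dim (eigenspace B 1)) (sqrt 1)
      + (\<Sum>t\<in>eigenvalues B - {1}. replicate_mset (dim (eigenspace B t)) (sqrt t))"
      unfolding M by (rule sum.remove[OF fin oev])
    also have "(\<Sum>t\<in>eigenvalues B - {1}. replicate_mset (dim (eigenspace B t)) (sqrt t))
      = replicate_mset (dim (eigenspace B t)) (sqrt t)
        + (\<Sum>t\<in>eigenvalues B - {1} - {t}. replicate_mset (dim (eigenspace B t)) (sqrt t))"
      using fin tev False by (intro sum.remove) auto
    finally show ?thesis
      using t01 eigenvalue_dim_pos[OF sym tev] eigenvalue_dim_pos[OF sym oev]
      by (simp add: filter_replicate_mset)
  qed
  have le: "sqrt t \<le> singular_value (CARD('n) - 1) A"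
    using sorted_list_of_multiset_second_largest[OF two]
    by (simp add: singular_value_def M_def[symmetric] size numeral_2_eq_2)
  show "0 \<le> singular_value (CARD('n) - 1) A" using le t01 by (meson order_trans real_sqrt_ge_zero)
  have "(norm (A *v v))\<^sup>2 \<le> t * (norm v)\<^sup>2"
    using w(4)[of v] v by (simp add: B S_def power2_norm_eq_inner[of v])
  then have "norm (A *v v) \<le> sqrt t * norm v"
    using real_le_rsqrt[of "norm (A *v v)" "t * (norm v)\<^sup>2"] by (simp add: real_sqrt_mult)
  then show "norm (A *v v) \<le> singular_value (CARD('n) - 1) A * norm v"
    using le by (meson mult_right_mono norm_ge_zero order_trans)
qed

subsection \<open>Weighted norms\<close>

text \<open>The square root of a diagonal matrix. It carries the weighted norms of the theorem to
  the Euclidean norm, so that Cauchy-Schwarz and the triangle inequality apply as they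
  stand.\<close>

definition weigh :: "('n \<Rightarrow> real) \<Rightarrow> real^'n \<Rightarrow> real^'n::finite" where
  "weigh w x = (\<chi> r. sqrt (w r) * x $ r)"

lemma linear_weigh [simp]: "linear (weigh w)"
  by (rule linearI) (auto simp: weigh_def vec_eq_iff algebra_simps)

lemmas weigh_add = linear_add[OF linear_weigh]
  and weigh_diff = linear_diff[OF linear_weigh]
  and weigh_scaleR = linear_scale[OF linear_weigh]

lemma inner_weigh: "(\<And>r. 0 \<le> w r) \<Longrightarrow> weigh w x \<bullet> weigh w y = (\<Sum>r\<in>UNIV. w r * (x $ r * y $ r))"
  by (auto simp: inner_vec_def weigh_def intro!: sum.cong)

lemma norm_weigh_squared:
  "(\<And>r. 0 \<le> w r) \<Longrightarrow> (norm (weigh w x))\<^sup>2 = (\<Sum>r\<in>UNIV. w r * (x $ r)\<^sup>2)"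
  unfolding power2_norm_eq_inner by (simp add: inner_weigh power2_eq_square)

lemma tendsto_zero_weigh:
  assumes "\<And>r. 0 < w r" "((\<lambda>k. norm (weigh w (f k))) \<longlongrightarrow> 0) net"
  shows "(f \<longlongrightarrow> 0) net"
proof (rule vec_tendstoI)
  fix r
  have "((\<lambda>k. weigh w (f k) $ r / sqrt (w r)) \<longlongrightarrow> 0 $ r / sqrt (w r)) net"
    using assms(1)[of r] by (intro tendsto_intros tendsto_norm_zero_cancel[OF assms(2)]) auto
  then show "((\<lambda>k. f k $ r) \<longlongrightarrow> 0 $ r) net"
    using assms(1)[of r] by (simp add: weigh_def)
qed

lemma diag_matrix_vector [simp]: "(diag_matrix d *v x) $ r = d r * x $ r"
  by (simp add: diag_matrix_def matrix_vector_mult_def if_distrib if_distribR cong: if_cong)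

lemma inner_wrt_diag_matrix:
  "(\<And>r. 0 \<le> w r) \<Longrightarrow> inner_wrt (diag_matrix w) x y = weigh w x \<bullet> weigh w y"
  by (simp add: inner_wrt_def inner_weigh) (simp add: inner_vec_def mult_ac)

lemma norm_wrt_diag_matrix:
  "(\<And>r. 0 \<le> w r) \<Longrightarrow> norm_wrt (diag_matrix w) x = norm (weigh w x)"
  using inner_wrt_diag_matrix[of w x x]
  by (simp add: norm_wrt_def inner_wrt_def norm_eq_sqrt_inner)

lemma kron_matrix_diag_one:
  "kron_matrix (diag_matrix d) (mat 1) = diag_matrix (\<lambda>r. d (fst r))"
  by (auto simp: kron_matrix_def diag_matrix_def mat_def vec_eq_iff prod_eq_iff)

lemma matrix_inv_diag_matrix:
  assumes "\<And>r. d r \<noteq> 0"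
  shows "(matrix_inv (diag_matrix d) *v x) $ r = x $ r / d r"
proof -
  let ?y = "\<chi> r. x $ r / d r"
  have "diag_matrix d *v ?y = x" using assms by (simp add: vec_eq_iff)
  moreover have "diag_matrix d ** diag_matrix (\<lambda>r. 1 / d r) = mat 1"
    "diag_matrix (\<lambda>r. 1 / d r) ** diag_matrix d = mat 1"
    using assms by (simp_all add: matrix_eq vec_eq_iff flip: matrix_vector_mul_assoc)
  then have "matrix_inv (diag_matrix d) ** diag_matrix d = mat 1"
    unfolding matrix_inv_def
    by (metis (mono_tags, lifting) someI_ex)
  ultimately have "matrix_inv (diag_matrix d) *v x = ?y"
    by (metis matrix_vector_mul_assoc matrix_vector_mul_lid)
  then show ?thesis by simp
qed

lemma eigenvalues_diag_matrix: "eigenvalues (diag_matrix d) = range d"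
proof
  show "eigenvalues (diag_matrix d) \<subseteq> range d"
  proof
    fix t assume "t \<in> eigenvalues (diag_matrix d)"
    then obtain v where "v \<noteq> 0" "diag_matrix d *v v = t *\<^sub>R v" unfolding eigenvalues_def by blast
    moreover then obtain r where "v $ r \<noteq> 0" by (auto simp: vec_eq_iff)
    ultimately have "d r = t"
      by (metis diag_matrix_vector mult_right_cancel vector_scaleR_component real_scaleR_def)
    then show "t \<in> range d" by blast
  qed
  have "axis r 1 \<noteq> (0 :: real^'a)" "diag_matrix d *v axis r 1 = d r *\<^sub>R axis r 1" for r
    by (auto simp: vec_eq_iff axis_def)
  then show "range d \<subseteq> eigenvalues (diag_matrix d)" unfolding eigenvalues_def by blast
qed

lemma lambda_min_diag_matrix: "lambda_min (diag_matrix d) = Min (range d)"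
  by (simp add: lambda_min_def eigenvalues_diag_matrix)

subsection \<open>Consensus\<close>

locale network =
  fixes W :: "real^'i^'i::finite" and q :: "real^'i" and \<sigma> :: real
  assumes card: "CARD('i) \<ge> 2"
    and W_nonneg: "\<And>i j. 0 \<le> W $ i $ j"
    and W_one: "W *v 1 = 1"
    and q_pos: "\<And>i. 0 < q $ i" and q_W: "q v* W = q" and q_sum: "1 \<bullet> q = 1"
    and \<sigma>: "\<sigma> = singular_value (CARD('i) - 1)
        (diag_matrix (\<lambda>i. sqrt (q $ i)) ** W ** diag_matrix (\<lambda>i. 1 / sqrt (q $ i)))"
begin

abbreviation "sc \<equiv> weigh (($) q)"
abbreviation "Sc \<equiv> weigh (\<lambda>r. q $ fst r)"

lemma q_nonneg: "0 \<le> q $ i" using q_pos[of i] by simp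

lemma sum_q: "(\<Sum>i\<in>UNIV. q $ i) = 1"
  using q_sum by (simp add: inner_vec_def)

lemma q_le_1: "q $ i \<le> 1"
  using member_le_sum[of i UNIV "($) q"] q_nonneg sum_q by simp

lemma sum_W: "(\<Sum>j\<in>UNIV. W $ i $ j) = 1"
  using W_one by (simp add: vec_eq_iff matrix_vector_mult_def)

lemma q_inner_W: "q \<bullet> (W *v v) = q \<bullet> v"
  by (metis dot_lmul_matrix q_W)

text \<open>The variance of \<open>v\<close> under the probability weights of row i is nonnegative,
  which gives Jensen's inequality for the square in every row. Summing the rows with weights q and
  using the invariance of q yields the claim.\<close>

lemma W_nonexpansive: "norm (sc (W *v v)) \<le> norm (sc v)"
proof -
  have row: "((W *v v) $ i)\<^sup>2 \<le> (\<Sum>j\<in>UNIV. W $ i $ j * (v $ j)\<^sup>2)" for i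
  proof -
    let ?m = "(W *v v) $ i"
    have m: "?m = (\<Sum>j\<in>UNIV. W $ i $ j * v $ j)" by (simp add: matrix_vector_mult_def)
    have "0 \<le> (\<Sum>j\<in>UNIV. W $ i $ j * (v $ j - ?m)\<^sup>2)"
      by (intro sum_nonneg mult_nonneg_nonneg W_nonneg) auto
    also have "\<dots> = (\<Sum>j\<in>UNIV. W $ i $ j * (v $ j)\<^sup>2 - 2 * ?m * (W $ i $ j * v $ j) + ?m\<^sup>2 * W $ i $ j)"
      by (intro sum.cong) (auto simp: power2_eq_square algebra_simps)
    also have "\<dots> = (\<Sum>j\<in>UNIV. W $ i $ j * (v $ j)\<^sup>2) - 2 * ?m * ?m + ?m\<^sup>2"
      by (simp only: sum.distrib sum_subtractf sum_distrib_left[symmetric] m[symmetric] sum_W mult_1_right)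
    finally show ?thesis by (simp add: power2_eq_square)
  qed
  have "(norm (sc (W *v v)))\<^sup>2 \<le> (\<Sum>i\<in>UNIV. q $ i * (\<Sum>j\<in>UNIV. W $ i $ j * (v $ j)\<^sup>2))"
    unfolding norm_weigh_squared[OF q_nonneg]
    by (intro sum_mono mult_left_mono row q_nonneg)
  also have "\<dots> = q \<bullet> (W *v (\<chi> j. (v $ j)\<^sup>2))"
    by (simp add: inner_vec_def matrix_vector_mult_def)
  also have "\<dots> = (norm (sc v))\<^sup>2"
    unfolding q_inner_W norm_weigh_squared[OF q_nonneg] by (simp add: inner_vec_def)
  finally show ?thesis by simp
qed

text \<open>\<open>sc\<close> conjugates \<open>W\<close> to the matrix \<open>A\<close> that
  defines \<sigma>. The vector \<open>sc 1\<close>, with entries \<open>sqrt (q $ i)\<close>, is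
  fixed by \<open>A\<close> because \<open>W\<close> fixes 1, and by its transpose because q is a
  left eigenvector; so \<open>transpose A ** A\<close> fixes it. The condition
  \<open>q \<bullet> v = 0\<close> says that \<open>sc v\<close> is orthogonal to it.\<close>

lemma consensus_contraction:
  shows "q \<bullet> v = 0 \<Longrightarrow> norm (sc (W *v v)) \<le> \<sigma> * norm (sc v)" and \<sigma>_nonneg: "0 \<le> \<sigma>"
proof -
  define A where "A = diag_matrix (\<lambda>i. sqrt (q $ i)) ** W ** diag_matrix (\<lambda>i. 1 / sqrt (q $ i))"
  have q0: "sqrt (q $ i) \<noteq> 0" for i using q_pos[of i] by simp
  have A: "A *v sc v = sc (W *v v)" for v
  proof -
    have "diag_matrix (\<lambda>i. 1 / sqrt (q $ i)) *v sc v = v"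
      using q0 by (simp add: vec_eq_iff weigh_def)
    then have "A *v sc v = diag_matrix (\<lambda>i. sqrt (q $ i)) *v (W *v v)"
      by (simp add: A_def flip: matrix_vector_mul_assoc)
    then show ?thesis by (simp add: weigh_def vec_eq_iff)
  qed
  have ex: "\<exists>v. x = sc v" for x
    using q0 by (intro exI[of _ "\<chi> i. x $ i / sqrt (q $ i)"]) (simp add: vec_eq_iff weigh_def)
  have one: "sc 1 \<bullet> sc v = q \<bullet> v" for v
    unfolding inner_weigh[OF q_nonneg] by (simp add: inner_vec_def)
  have nonexp: "norm (A *v x) \<le> norm x" for x
    using ex[of x] A W_nonexpansive by metis
  have "(transpose A *v sc 1) \<bullet> x = sc 1 \<bullet> x" for x
  proof -
    obtain v where x: "x = sc v" using ex by blast
    have "(transpose A *v sc 1) \<bullet> x = sc 1 \<bullet> (A *v x)"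
      by (metis dot_lmul_matrix transpose_matrix_vector)
    then show ?thesis unfolding x A one q_inner_W .
  qed
  then have "transpose A *v sc 1 = sc 1" by (metis vector_eq_rdot)
  then have u: "(transpose A ** A) *v sc 1 = sc 1"
    by (simp add: A W_one flip: matrix_vector_mul_assoc)
  have "sc 1 \<noteq> 0"
    using q0 by (simp add: vec_eq_iff weigh_def)
  note bound = second_singular_value_bound[OF card nonexp this u, folded \<sigma>[folded A_def]]
  show "norm (sc (W *v v)) \<le> \<sigma> * norm (sc v)" if "q \<bullet> v = 0"
    using bound(1)[of "sc v"] that by (simp add: one A)
  show "0 \<le> \<sigma>" using bound(2)[of 0] by simp
qed

text \<open>\<open>p\<close> is meant to hold the j-th entries of all agents' estimates of q. Its
  q-average is conserved and equals \<open>q $ j\<close> from the start, so the deviation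
  \<open>e\<close> has average 0 and shrinks by \<sigma> in every step.\<close>

lemma consensus_limit:
  assumes "\<sigma> < 1" and p0: "p 0 = axis j 1" and p: "\<And>k. p (Suc k) = W *v p k"
  shows "(\<lambda>k. p k $ i) \<longlonglongrightarrow> q $ j"
proof -
  define e where "e k = p k - q $ j *\<^sub>R 1" for k
  have qp: "q \<bullet> p k = q $ j" for k
    by (induction k) (auto simp: p0 p q_inner_W inner_axis)
  have "q \<bullet> e k = 0" for k
    using q_sum by (simp add: e_def inner_diff_right qp inner_commute)
  moreover have e: "e (Suc k) = W *v e k" for k
    by (simp add: e_def p matrix_vector_mult_diff_distrib matrix_vector_mult_scaleR W_one)
  ultimately have step: "norm (sc (e (Suc k))) \<le> \<sigma> * norm (sc (e k))" for k
    using consensus_contraction by simp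
  have pow: "norm (sc (e k)) \<le> \<sigma> ^ k * norm (sc (e 0))" for k
  proof (induction k)
    case (Suc k)
    then show ?case using step[of k] mult_left_mono[OF Suc \<sigma>_nonneg] by (simp add: mult.assoc)
  qed simp
  have "(\<lambda>k. \<sigma> ^ k * norm (sc (e 0))) \<longlonglongrightarrow> 0"
    using \<sigma>_nonneg assms(1) by (intro tendsto_mult_left_zero LIMSEQ_realpow_zero)
  then have "(\<lambda>k. norm (sc (e k))) \<longlonglongrightarrow> 0"
    by (rule Lim_null_comparison[rotated]) (simp add: pow)
  then have "e \<longlonglongrightarrow> 0" by (rule tendsto_zero_weigh[OF q_pos])
  then have "(\<lambda>k. e k $ i) \<longlonglongrightarrow> 0 $ i" by (rule tendsto_vec_nth)
  then show ?thesis by (simp add: e_def LIM_zero_iff)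
qed

section \<open>Stacked estimates: mixing, average and disagreement\<close>

definition mix :: "real^('i \<times> 'c::finite) \<Rightarrow> real^('i \<times> 'c)" where
  "mix z = (\<chi> r. \<Sum>j\<in>UNIV. W $ fst r $ j * z $ (j, snd r))"

definition average :: "real^('i \<times> 'c::finite) \<Rightarrow> real^'c" where
  "average z = (\<chi> c. \<Sum>j\<in>UNIV. q $ j * z $ (j, c))"

text \<open>All agents' estimates of one scalar coordinate. Mixing acts on each column as
  \<open>W\<close>, and squared weighted norms add up over columns, so facts about the network lift
  to stacks.\<close>

definition column :: "'c::finite \<Rightarrow> real^('i \<times> 'c) \<Rightarrow> real^'i" where
  "column c z = (\<chi> i. z $ (i, c))"

lemma norm_Sc_columns: "(norm (Sc z))\<^sup>2 = (\<Sum>c\<in>UNIV. (norm (sc (column c z)))\<^sup>2)"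
proof -
  have "(norm (Sc z))\<^sup>2 = (\<Sum>(i, c)\<in>UNIV. q $ i * (z $ (i, c))\<^sup>2)"
    by (simp add: norm_weigh_squared q_nonneg case_prod_unfold)
  also have "\<dots> = (\<Sum>i\<in>UNIV. \<Sum>c\<in>UNIV. q $ i * (z $ (i, c))\<^sup>2)"
    by (simp add: sum.cartesian_product)
  also have "\<dots> = (\<Sum>c\<in>UNIV. \<Sum>i\<in>UNIV. q $ i * (z $ (i, c))\<^sup>2)"
    by (rule sum.swap)
  finally show ?thesis by (simp add: norm_weigh_squared q_nonneg column_def)
qed

text \<open>Exhibits \<open>average\<close> as the adjoint of repeating a vector for all agents.
  Together with \<open>average_kron_one\<close>, repeating the average becomes the orthogonal
  projection onto consensus.\<close>

lemma inner_Sc_kron_one: "Sc (kron_vector 1 a) \<bullet> Sc z = a \<bullet> average z"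
proof -
  have "Sc (kron_vector 1 a) \<bullet> Sc z = (\<Sum>(i, c)\<in>UNIV. q $ i * (a $ c * z $ (i, c)))"
    by (simp add: inner_weigh q_nonneg case_prod_unfold kron_vector_def)
  also have "\<dots> = (\<Sum>i\<in>UNIV. \<Sum>c\<in>UNIV. q $ i * (a $ c * z $ (i, c)))"
    by (simp add: sum.cartesian_product)
  also have "\<dots> = (\<Sum>c\<in>UNIV. \<Sum>i\<in>UNIV. q $ i * (a $ c * z $ (i, c)))"
    by (rule sum.swap)
  also have "\<dots> = a \<bullet> average z"
    by (simp add: inner_vec_def average_def sum_distrib_left mult.left_commute)
  finally show ?thesis .
qed

lemma average_kron_one: "average (kron_vector 1 a) = a"
  by (simp add: average_def kron_vector_def vec_eq_iff sum_q flip: sum_distrib_right)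

lemma norm_Sc_kron_one: "norm (Sc (kron_vector 1 a)) = norm a"
  by (simp add: norm_eq_sqrt_inner inner_Sc_kron_one average_kron_one)

lemma average_diff: "average (y - z) = average y - average z"
  by (simp add: average_def vec_eq_iff algebra_simps sum_subtractf)

lemma average_column: "average z $ c = q \<bullet> column c z"
  by (simp add: average_def column_def inner_vec_def)

lemma column_mix: "column c (mix z) = W *v column c z"
  by (simp add: column_def mix_def vec_eq_iff matrix_vector_mult_def)

lemma average_mix: "average (mix z) = average z"
  by (simp add: vec_eq_iff average_column column_mix q_inner_W)

lemma mix_kron_one: "mix (kron_vector 1 a) = kron_vector 1 a"
  by (simp add: mix_def kron_vector_def vec_eq_iff sum_W flip: sum_distrib_right)

lemma mix_diff: "mix (y - z) = mix y - mix z"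
  by (simp add: mix_def vec_eq_iff algebra_simps sum_subtractf)

text \<open>Mixing fixes the consensus part \<open>u z\<close>, so \<open>mix z - u z\<close> is the
  mixed disagreement \<open>mix (z - u z)\<close>. Each column of \<open>z - u z\<close> has
  q-average 0, and \<open>consensus_contraction\<close> applies column by column.\<close>

lemma mix_decomposition:
  defines "u \<equiv> \<lambda>z. kron_vector 1 (average z)"
  shows mix_disagreement: "norm (Sc (mix z - u z)) \<le> \<sigma> * norm (Sc (z - u z))"
    and consensus_orthogonal: "Sc (u z) \<bullet> Sc (mix z - u z) = 0"
    and consensus_pythagoras: "(norm (Sc z))\<^sup>2 = (norm (Sc (u z)))\<^sup>2 + (norm (Sc (z - u z)))\<^sup>2"
proof -
  let ?p = "z - u z"
  have p: "average ?p = 0" by (simp add: average_diff u_def average_kron_one)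
  have inner: "Sc (u z) \<bullet> Sc y = average z \<bullet> average y" for y
    by (simp add: u_def inner_Sc_kron_one)
  have mp: "mix z - u z = mix ?p" by (simp add: mix_diff u_def mix_kron_one)
  have "(norm (Sc (mix ?p)))\<^sup>2 \<le> (\<Sum>c\<in>UNIV. (\<sigma> * norm (sc (column c ?p)))\<^sup>2)"
    unfolding norm_Sc_columns column_mix
    using p by (intro sum_mono power_mono consensus_contraction) (auto simp flip: average_column)
  also have "\<dots> = (\<sigma> * norm (Sc ?p))\<^sup>2"
    by (simp add: power_mult_distrib norm_Sc_columns sum_distrib_left)
  finally show "norm (Sc (mix z - u z)) \<le> \<sigma> * norm (Sc ?p)"
    unfolding mp using \<sigma>_nonneg by (simp add: power2_le_iff_abs_le)
  show "Sc (u z) \<bullet> Sc (mix z - u z) = 0"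
    unfolding mp inner average_mix p by simp
  have "Sc (u z) \<bullet> Sc ?p = 0"
    unfolding inner p by simp
  then show "(norm (Sc z))\<^sup>2 = (norm (Sc (u z)))\<^sup>2 + (norm (Sc ?p))\<^sup>2"
    by (simp add: weigh_diff power2_norm_eq_inner inner_diff_left inner_diff_right inner_commute)
qed

end

subsection \<open>Nash equilibria as solutions of a variational inequality\<close>

lemma GDERIV_unique:
  assumes "GDERIV f x :> g" "GDERIV f x :> h" shows "g = h"
proof -
  have "(\<lambda>v. v \<bullet> g) = (\<lambda>v. v \<bullet> h)"
    using assms unfolding gderiv_def by (rule has_derivative_unique)
  then have "\<forall>v. v \<bullet> g = v \<bullet> h" by (auto dest: fun_cong)
  then show ?thesis by (simp only: vector_eq_ldot)
qed

lemma GDERIV_gradient: "cont_differentiable f \<Longrightarrow> GDERIV f x :> gradient f x"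
  unfolding cont_differentiable_def gradient_def by (rule theI') (blast intro: GDERIV_unique)

lemma GDERIV_directional:
  assumes "GDERIV f x :> g"
  shows "((\<lambda>t. f (x + t *\<^sub>R d)) has_real_derivative d \<bullet> g) (at 0)"
proof -
  have "((\<lambda>t::real. x + t *\<^sub>R d) has_derivative (\<lambda>t. t *\<^sub>R d)) (at 0)"
    by (auto intro!: derivative_eq_intros)
  moreover have "(f has_derivative (\<lambda>h. h \<bullet> g)) (at (x + 0 *\<^sub>R d))"
    using assms by (simp add: gderiv_def)
  ultimately have "((\<lambda>t. f (x + t *\<^sub>R d)) has_derivative (\<lambda>t. t *\<^sub>R d \<bullet> g)) (at 0)"
    by (rule has_derivative_compose)
  then show ?thesis by (simp add: has_field_derivative_def mult_commute_abs)
qed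

lemma difference_quotient_at_right:
  assumes "(h has_real_derivative D) (at 0)"
  shows "((\<lambda>t. (h t - h 0) / t) \<longlongrightarrow> D) (at_right 0)"
  using assms unfolding has_field_derivative_iff by (simp add: filterlim_at_split)

lemma closest_point_eq_iff:
  fixes S :: "'a::euclidean_space set"
  assumes S: "convex S" "closed S" "S \<noteq> {}"
  shows "closest_point S a = p \<longleftrightarrow> p \<in> S \<and> (\<forall>y\<in>S. (a - p) \<bullet> (y - p) \<le> 0)"
proof (intro iffI)
  assume "closest_point S a = p"
  then show "p \<in> S \<and> (\<forall>y\<in>S. (a - p) \<bullet> (y - p) \<le> 0)"
    using closest_point_dot[OF S(1,2)] closest_point_in_set[OF S(2,3)] by blast
next
  assume p: "p \<in> S \<and> (\<forall>y\<in>S. (a - p) \<bullet> (y - p) \<le> 0)"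
  have "dist a p \<le> dist a z" if "z \<in> S" for z
  proof -
    have "(a - z) \<bullet> (a - z) = (a - p) \<bullet> (a - p) - 2 * ((a - p) \<bullet> (z - p)) + (z - p) \<bullet> (z - p)"
      by (simp add: inner_diff_left inner_diff_right inner_commute)
    moreover have "(a - p) \<bullet> (z - p) \<le> 0" using p that by blast
    ultimately have "(a - p) \<bullet> (a - p) \<le> (a - z) \<bullet> (a - z)"
      using inner_ge_zero[of "z - p"] by linarith
    then show ?thesis by (simp add: dist_norm norm_le)
  qed
  then show "closest_point S a = p"
    using closest_point_unique[OF S(1,2), of p a] p by auto
qed

section \<open>Blocks and first-order optimality conditions\<close>

lemma block_nth [simp]: "block own i x $ c = (if own c = i then x $ c else 0)"
  by (simp add: block_def)

lemma replace_block_nth [simp]: "replace_block own i y x $ c = (if own c = i then y $ c else x $ c)"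
  by (simp add: replace_block_def)

lemma linear_block: "linear (block own i)"
  by (rule linearI) (auto simp: vec_eq_iff)

lemma inner_blocks: "x \<bullet> y = (\<Sum>i\<in>UNIV. block own i x \<bullet> block own (i::'i::finite) y)"
proof -
  have "(\<Sum>i\<in>UNIV. block own i x \<bullet> block own i y)
      = (\<Sum>i\<in>UNIV. \<Sum>c\<in>UNIV. if own c = i then x $ c * y $ c else 0)"
    unfolding inner_vec_def by (intro sum.cong refl) auto
  also have "\<dots> = (\<Sum>c\<in>UNIV. \<Sum>i\<in>UNIV. if own c = i then x $ c * y $ c else 0)"
    by (rule sum.swap)
  finally show ?thesis by (simp add: inner_vec_def)
qed

lemma block_block_space: "y \<in> block_space own i \<Longrightarrow> block own i y = y"
  by (auto simp: block_space_def vec_eq_iff)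

locale game =
  fixes own :: "'c::finite \<Rightarrow> 'i::finite"
    and \<Omega> :: "'i \<Rightarrow> (real^'c) set"
    and J :: "'i \<Rightarrow> real^'c \<Rightarrow> real"
  assumes strategy_sets:
      "\<And>i. \<Omega> i \<subseteq> block_space own i \<and> \<Omega> i \<noteq> {} \<and> closed (\<Omega> i) \<and> convex (\<Omega> i)"
    and cost_convex: "\<And>i z. convex_on (block_space own i) (\<lambda>y. J i (replace_block own i y z))"
    and cost_C1: "\<And>i z. cont_differentiable (\<lambda>y. J i (replace_block own i y z))"
begin

abbreviation "G \<equiv> partial_grad own J"
abbreviation "F \<equiv> pseudo_grad own J"
abbreviation "bl \<equiv> block own"
abbreviation "JS \<equiv> joint_set own \<Omega>"

lemma block_strategy: "y \<in> \<Omega> i \<Longrightarrow> bl i y = y"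
  using block_block_space[of y own i] strategy_sets[of i] by auto

lemma GDERIV_partial_grad: "GDERIV (\<lambda>y. J i (replace_block own i y z)) z :> G i z"
  unfolding partial_grad_def by (rule GDERIV_gradient[OF cost_C1])

lemma partial_grad_block_space: "own c \<noteq> i \<Longrightarrow> G i z $ c = 0"
proof -
  assume c: "own c \<noteq> i"
  have "replace_block own i (z + t *\<^sub>R axis c 1) z = z" for t
    using c by (auto simp: vec_eq_iff axis_def)
  then have "((\<lambda>t. J i z) has_real_derivative axis c 1 \<bullet> G i z) (at 0)"
    using GDERIV_directional[OF GDERIV_partial_grad, of i z "axis c 1"] by simp
  then have "axis c 1 \<bullet> G i z = 0"
    using DERIV_const DERIV_unique by blast
  then show ?thesis by (simp add: inner_axis')
qed

lemma block_pseudo_grad: "bl i (F z) = G i z"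
  using partial_grad_block_space by (auto simp: vec_eq_iff pseudo_grad_def)

lemma partial_grad_difference_quotient:
  "((\<lambda>t. (J i (replace_block own i (z + t *\<^sub>R (y - bl i z)) z) - J i z) / t)
     \<longlongrightarrow> G i z \<bullet> (y - bl i z)) (at_right 0)"
proof -
  have "replace_block own i z z = z" by (simp add: vec_eq_iff)
  then show ?thesis
    using difference_quotient_at_right[OF GDERIV_directional[OF GDERIV_partial_grad, of i z "y - bl i z"]]
    by (simp add: inner_commute)
qed

text \<open>Turns the points of the difference quotient into convex combinations of two strategies
  of agent i, where minimality and convexity can be used.\<close>

lemma replace_block_segment:
  "replace_block own i (z + t *\<^sub>R (y - bl i z)) z
    = replace_block own i ((1 - t) *\<^sub>R bl i z + t *\<^sub>R y) z"
  by (auto simp: vec_eq_iff algebra_simps)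

lemma replace_block_self: "replace_block own i (bl i z) z = z"
  by (auto simp: vec_eq_iff)

text \<open>At a minimum all difference quotients towards \<open>y\<close> are nonnegative, hence so
  is their limit. Conversely, convexity bounds each quotient by the full difference at
  \<open>t = 1\<close>, so a nonnegative limit makes that difference nonnegative.\<close>

lemma nash_equilibrium_iff:
  "nash_equilibrium own \<Omega> J z \<longleftrightarrow>
     (\<forall>i. bl i z \<in> \<Omega> i \<and> (\<forall>y\<in>\<Omega> i. 0 \<le> G i z \<bullet> (y - bl i z)))"
proof -
  have "(\<forall>y\<in>\<Omega> i. J i z \<le> J i (replace_block own i y z)) \<longleftrightarrow> (\<forall>y\<in>\<Omega> i. 0 \<le> G i z \<bullet> (y - bl i z))"
    if z: "bl i z \<in> \<Omega> i" for i
  proof (intro iffI ballI)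
    fix y assume min: "\<forall>y\<in>\<Omega> i. J i z \<le> J i (replace_block own i y z)" and y: "y \<in> \<Omega> i"
    have "0 \<le> (J i (replace_block own i (z + t *\<^sub>R (y - bl i z)) z) - J i z) / t"
      if "0 < t" "t < 1" for t
    proof -
      have "(1 - t) *\<^sub>R bl i z + t *\<^sub>R y \<in> \<Omega> i"
        using strategy_sets[of i] z y that by (intro convexD) auto
      then show ?thesis using min that by (simp add: replace_block_segment)
    qed
    then have "\<forall>\<^sub>F t in at_right 0. 0 \<le> (J i (replace_block own i (z + t *\<^sub>R (y - bl i z)) z) - J i z) / t"
      unfolding eventually_at_right_field by (intro exI[of _ 1]) auto
    then show "0 \<le> G i z \<bullet> (y - bl i z)"
      by (intro tendsto_lowerbound[OF partial_grad_difference_quotient]) auto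
  next
    fix y assume vi: "\<forall>y\<in>\<Omega> i. 0 \<le> G i z \<bullet> (y - bl i z)" and y: "y \<in> \<Omega> i"
    have sp: "y \<in> block_space own i" "bl i z \<in> block_space own i"
      using strategy_sets[of i] y z by blast+
    have "(J i (replace_block own i (z + t *\<^sub>R (y - bl i z)) z) - J i z) / t
        \<le> J i (replace_block own i y z) - J i z"
      if "0 < t" "t < 1" for t
    proof -
      have "J i (replace_block own i ((1 - t) *\<^sub>R bl i z + t *\<^sub>R y) z)
          \<le> (1 - t) * J i (replace_block own i (bl i z) z) + t * J i (replace_block own i y z)"
        using convex_onD[OF cost_convex[of i z], of t "bl i z" y] sp that by simp
      then have "J i (replace_block own i (z + t *\<^sub>R (y - bl i z)) z) - J i z
          \<le> t * (J i (replace_block own i y z) - J i z)"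
        unfolding replace_block_segment replace_block_self
        by (simp add: left_diff_distrib right_diff_distrib)
      then show ?thesis using that by (simp add: divide_le_eq mult.commute)
    qed
    then have "\<forall>\<^sub>F t in at_right 0. (J i (replace_block own i (z + t *\<^sub>R (y - bl i z)) z) - J i z) / t
        \<le> J i (replace_block own i y z) - J i z"
      unfolding eventually_at_right_field by (intro exI[of _ 1]) auto
    then have "G i z \<bullet> (y - bl i z) \<le> J i (replace_block own i y z) - J i z"
      by (intro tendsto_upperbound[OF partial_grad_difference_quotient]) auto
    then show "J i z \<le> J i (replace_block own i y z)" using vi y by fastforce
  qed
  then show ?thesis
    unfolding nash_equilibrium_def joint_set_def by (auto simp: le_INF_iff)
qed

text \<open>The inequality characterising the projection is the agent's optimality condition
  multiplied by \<open>t\<close>. Each agent may thus use a step of its own without moving the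
  equilibrium.\<close>

lemma nash_equilibrium_projection:
  assumes "nash_equilibrium own \<Omega> J z" "0 \<le> t"
  shows "closest_point (\<Omega> i) (bl i z - t *\<^sub>R G i z) = bl i z"
proof -
  have "convex (\<Omega> i)" "closed (\<Omega> i)" "\<Omega> i \<noteq> {}" using strategy_sets by auto
  then show ?thesis
    using assms by (subst closest_point_eq_iff) (auto simp: nash_equilibrium_iff)
qed

lemma joint_set: "convex JS" "closed JS" "JS \<noteq> {}"
proof -
  have JS: "JS = (\<Inter>i. bl i -` \<Omega> i)" by (auto simp: joint_set_def)
  show "convex JS" unfolding JS
    using strategy_sets by (intro convex_INT convex_linear_vimage linear_block) auto
  show "closed JS" unfolding JS
    using strategy_sets
    by (intro closed_INT ballI closed_vimage linear_continuous_on linear_conv_bounded_linear[THEN iffD1] linear_block) auto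
  have "\<forall>i. \<exists>y. y \<in> \<Omega> i" using strategy_sets by blast
  then obtain w where w: "\<And>i. w i \<in> \<Omega> i" by metis
  have "bl i (\<chi> c. w (own c) $ c) = w i" for i
    using w[of i] strategy_sets[of i] by (auto simp: vec_eq_iff block_space_def)
  then have "(\<chi> c. w (own c) $ c) \<in> JS" using w by (simp add: joint_set_def)
  then show "JS \<noteq> {}" by blast
qed

text \<open>Summing the conditions of all agents gives the joint inequality. In the other direction
  it is tested with points that change a single block, which stay in the product set.\<close>

lemma nash_equilibrium_iff_joint:
  "nash_equilibrium own \<Omega> J z \<longleftrightarrow> z \<in> JS \<and> (\<forall>y\<in>JS. 0 \<le> F z \<bullet> (y - z))"
proof (intro iffI conjI ballI)
  assume n: "nash_equilibrium own \<Omega> J z"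
  then show "z \<in> JS" by (simp add: nash_equilibrium_def)
  fix y assume "y \<in> JS"
  then have "0 \<le> bl i (F z) \<bullet> bl i (y - z)" for i
    using n unfolding nash_equilibrium_iff block_pseudo_grad linear_diff[OF linear_block]
    by (auto simp: joint_set_def)
  then show "0 \<le> F z \<bullet> (y - z)"
    unfolding inner_blocks[of "F z" "y - z" own] by (intro sum_nonneg) auto
next
  assume z: "z \<in> JS \<and> (\<forall>y\<in>JS. 0 \<le> F z \<bullet> (y - z))"
  show "nash_equilibrium own \<Omega> J z"
    unfolding nash_equilibrium_iff
  proof (intro allI conjI ballI)
    fix i
    show "bl i z \<in> \<Omega> i" using z by (simp add: joint_set_def)
    fix y assume y: "y \<in> \<Omega> i"
    let ?r = "replace_block own i y z"
    have "bl j ?r = (if j = i then bl i y else bl j z)" for j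
      by (auto simp: vec_eq_iff)
    then have "?r \<in> JS" using z y block_strategy[OF y] by (auto simp: joint_set_def)
    then have "0 \<le> F z \<bullet> (?r - z)" using z by blast
    also have "?r - z = bl i (y - z)" by (auto simp: vec_eq_iff)
    also have "F z \<bullet> bl i (y - z) = bl i (F z) \<bullet> bl i (y - z)"
      by (auto simp: inner_vec_def intro!: sum.cong)
    finally show "0 \<le> G i z \<bullet> (y - bl i z)"
      by (simp add: block_pseudo_grad linear_diff[OF linear_block] block_strategy[OF y])
  qed
qed

lemma nash_equilibrium_exists_unique:
  assumes "\<mu> > 0" and mono: "\<And>y z. (F y - F z) \<bullet> (y - z) \<ge> \<mu> * (norm (y - z))\<^sup>2"
    and L: "L > 0" "L-lipschitz_on UNIV F"
  shows "\<exists>!z. nash_equilibrium own \<Omega> J z"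
proof -
  \<comment> \<open>Expanding the square bounds the squared Lipschitz constant of \<open>T\<close>
    by \<open>1 - 2 * t * \<mu> + t\<^sup>2 * L\<^sup>2\<close>. This \<open>t\<close> minimises it,
    with value \<open>1 - \<mu>\<^sup>2 / L\<^sup>2\<close>; the \<open>max 0\<close> in
    \<open>c\<close> spares the proof that \<mu> is at most \<open>L\<close>.\<close>
  define t where "t = \<mu> / L\<^sup>2"
  define T where "T z = closest_point JS (z - t *\<^sub>R F z)" for z
  define c where "c = sqrt (max 0 (1 - \<mu>\<^sup>2 / L\<^sup>2))"
  have t: "t > 0" using assms by (simp add: t_def)
  have nash: "nash_equilibrium own \<Omega> J z \<longleftrightarrow> z \<in> JS \<and> T z = z" for z
    unfolding T_def nash_equilibrium_iff_joint closest_point_eq_iff[OF joint_set]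
    using t by (auto simp: mult_le_0_iff zero_le_mult_iff)
  have "\<exists>!z\<in>JS. T z = z"
  proof (rule Banach_fix)
    show "complete JS" using joint_set complete_eq_closed by blast
    show "JS \<noteq> {}" by (rule joint_set)
    show "0 \<le> c" "c < 1" using assms by (auto simp: c_def)
    show "T ` JS \<subseteq> JS" using joint_set closest_point_in_set by (auto simp: T_def)
    fix x y
    have "norm (F x - F y) \<le> L * norm (x - y)"
      using lipschitz_onD[OF L(2), of x y] by (simp add: dist_norm)
    then have "(norm (F x - F y))\<^sup>2 \<le> (L * norm (x - y))\<^sup>2" by (intro power_mono) auto
    then have "t\<^sup>2 * (norm (F x - F y))\<^sup>2 \<le> t\<^sup>2 * (L * norm (x - y))\<^sup>2" by (intro mult_left_mono) auto
    moreover have "2 * t * (\<mu> * (norm (x - y))\<^sup>2) \<le> 2 * t * ((F x - F y) \<bullet> (x - y))"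
      using mono t by (intro mult_left_mono) auto
    moreover have "(norm ((x - t *\<^sub>R F x) - (y - t *\<^sub>R F y)))\<^sup>2
        = (norm (x - y))\<^sup>2 - 2 * t * ((F x - F y) \<bullet> (x - y)) + t\<^sup>2 * (norm (F x - F y))\<^sup>2"
    proof -
      have eq: "(x - t *\<^sub>R F x) - (y - t *\<^sub>R F y) = (x - y) - t *\<^sub>R (F x - F y)"
        by (simp add: algebra_simps)
      show ?thesis
        unfolding power2_norm_eq_inner eq inner_diff_left[of "x - y"] inner_diff_right[of _ "x - y"]
        by (simp only: inner_scaleR_left inner_scaleR_right inner_commute[of "x - y" "F x - F y"])
          (simp add: power2_eq_square right_diff_distrib)
    qed
    ultimately have "(norm ((x - t *\<^sub>R F x) - (y - t *\<^sub>R F y)))\<^sup>2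
        \<le> (norm (x - y))\<^sup>2 - 2 * t * (\<mu> * (norm (x - y))\<^sup>2) + t\<^sup>2 * (L * norm (x - y))\<^sup>2"
      by linarith
    also have "\<dots> = (1 - \<mu>\<^sup>2 / L\<^sup>2) * (norm (x - y))\<^sup>2"
      using L by (simp add: t_def field_simps power2_eq_square)
    also have "\<dots> \<le> (c * norm (x - y))\<^sup>2"
      unfolding power_mult_distrib c_def by (intro mult_right_mono) auto
    finally have "norm ((x - t *\<^sub>R F x) - (y - t *\<^sub>R F y)) \<le> c * norm (x - y)"
      by (rule power2_le_imp_le) (auto simp: c_def)
    then show "dist (T x) (T y) \<le> c * dist x y"
      using closest_point_lipschitz[OF joint_set, of "x - t *\<^sub>R F x" "y - t *\<^sub>R F y"]
      by (simp add: T_def dist_norm)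
  qed
  then show ?thesis unfolding nash .
qed

end

lemma norm_vec_squared: "(norm (a :: real^'n::finite))\<^sup>2 = (\<Sum>c\<in>UNIV. (a $ c)\<^sup>2)"
  by (simp add: norm_vec_def L2_set_def sum_nonneg)

subsection \<open>The contraction matrix\<close>

text \<open>Nonnegative trace means that the largest eigenvalue is also the largest in absolute
  value. By Cayley-Hamilton |M v|^2 is the trace times \<open>v \<bullet> (M *v v)\<close> minus the
  determinant times |v|^2; as the trace is nonnegative, the Rayleigh bound may be inserted, and the
  characteristic equation turns the result into \<open>(?r * norm v)\<^sup>2\<close>.\<close>

lemma onorm_symmetric_2:
  fixes M :: "real^2^2"
  assumes sym: "transpose M = M" and tr: "0 \<le> M $ 1 $ 1 + M $ 2 $ 2"
  shows "lambda_max M = onorm (\<lambda>v. M *v v)" and "0 \<le> lambda_max M"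
proof -
  define t where "t = M $ 1 $ 1 + M $ 2 $ 2"
  define D where "D = M $ 1 $ 1 * M $ 2 $ 2 - M $ 1 $ 2 * M $ 1 $ 2"
  let ?r = "lambda_max M"
  have "M $ 2 $ 1 = M $ 1 $ 2"
    using arg_cong[OF sym, of "\<lambda>A. A $ 2 $ 1"] by (simp add: transpose_def)
  then have CH: "(M *v v) \<bullet> (M *v v) = t * (v \<bullet> (M *v v)) - D * (v \<bullet> v)" for v
    by (simp add: t_def D_def inner_vec_def matrix_vector_mult_def sum_2) (simp add: algebra_simps)
  obtain w where w: "w \<noteq> 0" "M *v w = ?r *\<^sub>R w"
    using lambda_max_eigenvalue[OF sym] unfolding eigenvalues_def by blast
  have "(?r * ?r - t * ?r + D) * (w \<bullet> w) = 0"
    using CH[of w] by (simp add: w(2) algebra_simps)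
  then have r: "?r * ?r = t * ?r - D" using w(1) by simp
  have "M $ i $ i \<le> ?r" for i
    using lambda_max_ge[OF sym, of "axis i 1"]
    by (simp add: inner_axis' inner_axis matrix_vector_mul_component)
  then show r0: "0 \<le> ?r" using tr by (smt (verit))
  have le: "norm (M *v v) \<le> ?r * norm v" for v
  proof -
    have "(norm (M *v v))\<^sup>2 \<le> t * (?r * (v \<bullet> v)) - D * (v \<bullet> v)"
      unfolding power2_norm_eq_inner CH
      using tr by (intro diff_right_mono mult_left_mono lambda_max_ge[OF sym]) (simp add: t_def)
    also have "\<dots> = (?r * ?r) * (v \<bullet> v)" unfolding r by (simp add: algebra_simps)
    also have "\<dots> = (?r * norm v)\<^sup>2" by (simp only: power_mult_distrib power2_norm_eq_inner power2_eq_square[of ?r])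
    finally show ?thesis by (rule power2_le_imp_le) (use r0 in simp)
  qed
  show "?r = onorm (\<lambda>v. M *v v)"
  proof (rule antisym)
    have "bounded_linear (\<lambda>v. M *v v)" by (rule matrix_vector_mul_bounded_linear)
    from onorm[OF this, of w] have "?r * norm w \<le> onorm (\<lambda>v. M *v v) * norm w"
      using r0 by (simp add: w(2))
    then show "?r \<le> onorm (\<lambda>v. M *v v)" using w(1) by simp
    show "onorm (\<lambda>v. M *v v) \<le> ?r" by (rule onorm_le[OF le])
  qed
qed

lemma contraction_matrix_nth [simp]:
  "contraction_matrix \<alpha> m l s c $ 1 $ 1 = 1 - 2 * \<alpha> * m * c + \<alpha>^2 * l^2"
  "contraction_matrix \<alpha> m l s c $ 1 $ 2 = 2 * \<alpha> * l * s"
  "contraction_matrix \<alpha> m l s c $ 2 $ 1 = 2 * \<alpha> * l * s"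
  "contraction_matrix \<alpha> m l s c $ 2 $ 2 = (1 + 2 * \<alpha> * l + \<alpha>^2 * l^2) * s^2"
  by (simp_all add: contraction_matrix_def)

lemma transpose_contraction_matrix:
  "transpose (contraction_matrix \<alpha> m l s c) = contraction_matrix \<alpha> m l s c"
  by (simp add: vec_eq_iff transpose_def forall_2)

text \<open>The quadratic form at (a, b), where the off-diagonal entry counts twice. Each factor
  \<open>s\<close> stays with \<open>b\<close>: the disagreement has already been shrunk by mixing
  when the gradient acts on it.\<close>

lemma contraction_matrix_form_le:
  "(1 - 2 * \<alpha> * m * c + \<alpha>^2 * l^2) * a\<^sup>2 + 4 * \<alpha> * l * a * (s * b) + (1 + 2 * \<alpha> * l + \<alpha>^2 * l^2) * (s * b)\<^sup>2
    \<le> lambda_max (contraction_matrix \<alpha> m l s c) * (a\<^sup>2 + b\<^sup>2)"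
  using lambda_max_ge[OF transpose_contraction_matrix, of "vector [a, b]" \<alpha> m l s c]
  by (simp add: inner_vec_def matrix_vector_mult_def sum_2) (simp add: algebra_simps power2_eq_square)

text \<open>\<open>u\<close> is the consensus part of the error and \<open>v\<close> the
  disagreement; \<open>g\<close> and \<open>h\<close> are the gradient changes they cause.
  Monotonicity serves the product of \<open>g\<close> and \<open>u\<close> only. The products of
  \<open>g\<close> with \<open>v\<close> and of \<open>h\<close> with \<open>u\<close> cost
  \<open>l * norm u * norm v\<close> each, whence the factor 4. The second-order term uses the bound
  on \<open>g + h\<close> as a whole with Pythagoras, so it has no mixed product.\<close>

lemma gradient_step_bound:
  fixes u v g h :: "'a::real_inner"
  assumes "u \<bullet> v = 0" "0 \<le> a"
    and g: "norm g \<le> l * norm u" and h: "norm h \<le> l * norm v" and gh: "norm (g + h) \<le> l * norm (u + v)"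
    and k: "k * (norm u)\<^sup>2 \<le> g \<bullet> u"
  shows "(norm (u + v - a *\<^sub>R (g + h)))\<^sup>2
    \<le> (1 - 2 * a * k + a\<^sup>2 * l\<^sup>2) * (norm u)\<^sup>2 + 4 * a * l * norm u * norm v
      + (1 + 2 * a * l + a\<^sup>2 * l\<^sup>2) * (norm v)\<^sup>2"
proof -
  have uv: "(norm (u + v))\<^sup>2 = (norm u)\<^sup>2 + (norm v)\<^sup>2"
    using assms(1) by (simp add: power2_norm_eq_inner inner_add_left inner_add_right inner_commute)
  have "(norm (g + h))\<^sup>2 \<le> (l * norm (u + v))\<^sup>2" using gh by (intro power_mono) auto
  then have G: "(norm (g + h))\<^sup>2 \<le> l\<^sup>2 * ((norm u)\<^sup>2 + (norm v)\<^sup>2)" by (simp add: power_mult_distrib uv)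
  have cross: "- (l * norm p * norm r) \<le> z \<bullet> r" if "norm z \<le> l * norm p" for z p r :: 'a
    using Cauchy_Schwarz_ineq2[of z r] mult_right_mono[OF that norm_ge_zero[of r]] by linarith
  have "k * (norm u)\<^sup>2 - 2 * (l * norm u * norm v) - l * (norm v)\<^sup>2 \<le> (g + h) \<bullet> (u + v)"
    using k cross[OF g, of v] cross[OF h, of u] cross[OF h, of v]
    by (simp add: inner_add_left inner_add_right power2_eq_square mult.assoc mult.commute[of "norm v" "norm u"])
  then have C: "2 * a * (k * (norm u)\<^sup>2 - 2 * (l * norm u * norm v) - l * (norm v)\<^sup>2) \<le> 2 * a * ((g + h) \<bullet> (u + v))"
    using \<open>0 \<le> a\<close> by (intro mult_left_mono) auto
  have "(norm (u + v - a *\<^sub>R (g + h)))\<^sup>2 = (norm (u + v))\<^sup>2 - 2 * a * ((g + h) \<bullet> (u + v)) + a\<^sup>2 * (norm (g + h))\<^sup>2"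
    unfolding power2_norm_eq_inner inner_diff_left[of "u + v"] inner_diff_right[of _ "u + v"]
    by (simp only: inner_scaleR_left inner_scaleR_right inner_commute[of "u + v" "g + h"])
      (simp add: power2_eq_square right_diff_distrib)
  also have "\<dots> \<le> ((norm u)\<^sup>2 + (norm v)\<^sup>2)
      - 2 * a * (k * (norm u)\<^sup>2 - 2 * (l * norm u * norm v) - l * (norm v)\<^sup>2)
      + a\<^sup>2 * (l\<^sup>2 * ((norm u)\<^sup>2 + (norm v)\<^sup>2))"
    unfolding uv using C mult_left_mono[OF G, of "a\<^sup>2"] by simp
  also have "\<dots> = (1 - 2 * a * k + a\<^sup>2 * l\<^sup>2) * (norm u)\<^sup>2 + 4 * a * l * norm u * norm v
      + (1 + 2 * a * l + a\<^sup>2 * l\<^sup>2) * (norm v)\<^sup>2"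
    by (simp add: algebra_simps)
  finally show ?thesis .
qed

lemma perturbed_linear_rate:
  fixes a e :: "nat \<Rightarrow> real"
  assumes step: "\<And>k. a (Suc k) \<le> (r + e k) * a k" and e: "e \<longlonglongrightarrow> 0" "\<And>k. 0 \<le> e k"
    and a: "\<And>k. 0 \<le> a k" and r: "0 \<le> r" and "0 < \<epsilon>"
  shows "\<exists>K>0. \<forall>k. a k \<le> K * (r + \<epsilon>) ^ k * a 0"
proof -
  let ?b = "r + \<epsilon>"
  have b: "0 < ?b" using assms by simp
  obtain N where N: "\<And>k. k \<ge> N \<Longrightarrow> e k < \<epsilon>"
    using order_tendstoD(2)[OF e(1) \<open>0 < \<epsilon>\<close>] by (auto simp: eventually_sequentially)
  have "\<exists>K>0. \<forall>j\<le>k. a j \<le> K * ?b ^ j * a 0" for k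
  proof (induction k)
    case 0 show ?case by (intro exI[of _ 1]) auto
  next
    case (Suc k)
    then obtain K where K: "K > 0" "\<And>j. j \<le> k \<Longrightarrow> a j \<le> K * ?b ^ j * a 0" by blast
    \<comment> \<open>The summand 1 keeps the earlier bounds, the other one covers step
      \<open>Suc k\<close>. The constant grows multiplicatively because \<open>a 0\<close> may be 0,
      which rules out taking quotients by it.\<close>
    let ?L = "K * (1 + (r + e k) / ?b)"
    have c: "0 \<le> (r + e k) / ?b" using r e(2)[of k] b by simp
    have "K \<le> ?L" using K(1) c by simp
    have L: "K * ?b ^ j * a 0 \<le> ?L * ?b ^ j * a 0" for j
      using \<open>K \<le> ?L\<close> b a by (intro mult_right_mono) auto
    have "a (Suc k) \<le> (r + e k) * (K * ?b ^ k * a 0)"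
      using step[of k] K(2)[of k] mult_left_mono[of "a k" "K * ?b ^ k * a 0" "r + e k"] r e(2)[of k] by simp
    also have "\<dots> = K * ((r + e k) / ?b) * ?b ^ Suc k * a 0" using b by simp
    also have "\<dots> \<le> ?L * ?b ^ Suc k * a 0"
      using K(1) b a by (intro mult_right_mono mult_left_mono) auto
    finally have "a (Suc k) \<le> ?L * ?b ^ Suc k * a 0" .
    then have "\<forall>j\<le>Suc k. a j \<le> ?L * ?b ^ j * a 0"
      using K(2) L by (auto simp: le_Suc_eq intro: order_trans)
    moreover have "?L > 0" using K(1) c by simp
    ultimately show ?case by blast
  qed
  then obtain K where K: "K > 0" "\<And>j. j \<le> N \<Longrightarrow> a j \<le> K * ?b ^ j * a 0" by blast
  have "a k \<le> K * ?b ^ k * a 0" for k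
  proof (cases "k \<le> N")
    case False
    then have "N \<le> k" by simp
    then show ?thesis
    proof (induction k rule: dec_induct)
      case base show ?case using K(2) by simp
    next
      case (step k)
      have "a (Suc k) \<le> ?b * a k"
        using assms(1)[of k] N[OF step(1)] mult_right_mono[OF _ a[of k], of "r + e k" ?b] by linarith
      also have "\<dots> \<le> ?b * (K * ?b ^ k * a 0)" using step b by (intro mult_left_mono) auto
      finally show ?case by (simp add: mult_ac)
    qed
  qed (use K in auto)
  with K(1) show ?thesis by blast
qed

subsection \<open>Convergence of the algorithm\<close>

locale seeking = network W q \<sigma> + game own \<Omega> J
  for W :: "real^'i^'i::finite" and q \<sigma>
    and own :: "'c::finite \<Rightarrow> 'i" and \<Omega> J +
  fixes m l :: real
  assumes m: "0 < m" and l: "0 < l"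
    and monotone: "\<And>y z. m * (norm (weigh (\<lambda>c. q $ own c) (y - z)))\<^sup>2
      \<le> weigh (\<lambda>c. q $ own c) (\<chi> c. (F y - F z) $ c / q $ own c) \<bullet> weigh (\<lambda>c. q $ own c) (y - z)"
    and lipschitz: "\<And>y z. norm (weigh (\<lambda>c. q $ own c)
        (\<chi> c. (ext_pseudo_grad own J y - ext_pseudo_grad own J z) $ c / q $ own c)) \<le> l * norm (Sc (y - z))"
begin

abbreviation "sb \<equiv> weigh (\<lambda>c. q $ own c)"

text \<open>The division cancels the weights in \<open>sb y \<bullet> sb z\<close>: between
  consensus stacks, the weighted product of a difference of \<open>EF\<close> with a vector is the
  plain product of the difference of \<open>F\<close> with it.\<close>

definition "EF y = (\<chi> c. ext_pseudo_grad own J y $ c / q $ own c)"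

lemma EF_diff: "EF y - EF z = (\<chi> c. (ext_pseudo_grad own J y - ext_pseudo_grad own J z) $ c / q $ own c)"
  by (simp add: EF_def vec_eq_iff diff_divide_distrib)

lemma lipschitz_EF: "norm (sb (EF y - EF z)) \<le> l * norm (Sc (y - z))"
  unfolding EF_diff by (rule lipschitz)

lemma estimate_kron_one: "estimate (kron_vector 1 a) i = a"
  by (simp add: estimate_def kron_vector_def vec_eq_iff)

lemma ext_pseudo_grad_kron_one: "ext_pseudo_grad own J (kron_vector 1 a) = F a"
  by (simp add: ext_pseudo_grad_def pseudo_grad_def vec_eq_iff estimate_kron_one)

lemma kron_one_diff: "kron_vector 1 a - kron_vector 1 b = kron_vector 1 (a - b)"
  by (simp add: kron_vector_def vec_eq_iff)

lemma monotone_EF: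
  "m * (norm (sb (a - b)))\<^sup>2 \<le> sb (EF (kron_vector 1 a) - EF (kron_vector 1 b)) \<bullet> sb (a - b)"
  unfolding EF_diff ext_pseudo_grad_kron_one by (rule monotone)

text \<open>The adjoint of reading off the agents' own strategies: places block \<open>i\<close> into the stack of agent \<open>i\<close>.\<close>

definition embed :: "real^'c \<Rightarrow> real^('i \<times> 'c)" where
  "embed g = (\<chi> r. if own (snd r) = fst r then g $ snd r else 0)"

definition own_part :: "real^('i \<times> 'c) \<Rightarrow> real^'c" where
  "own_part z = (\<chi> c. z $ (own c, c))"

lemma inner_Sc_embed: "Sc (embed g) \<bullet> Sc z = sb g \<bullet> sb (own_part z)"
proof -
  have "Sc (embed g) \<bullet> Sc z
      = (\<Sum>(i, c)\<in>UNIV. if own c = i then q $ i * (g $ c * z $ (i, c)) else 0)"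
    unfolding inner_weigh[OF q_nonneg] embed_def by (intro sum.cong) auto
  also have "\<dots> = (\<Sum>i\<in>UNIV. \<Sum>c\<in>UNIV. if own c = i then q $ i * (g $ c * z $ (i, c)) else 0)"
    by (simp add: sum.cartesian_product)
  also have "\<dots> = (\<Sum>c\<in>UNIV. \<Sum>i\<in>UNIV. if own c = i then q $ i * (g $ c * z $ (i, c)) else 0)"
    by (rule sum.swap)
  also have "\<dots> = sb g \<bullet> sb (own_part z)"
    unfolding inner_weigh[OF q_nonneg] own_part_def by simp
  finally show ?thesis .
qed

lemma norm_Sc_embed: "norm (Sc (embed g)) = norm (sb g)"
proof -
  have "own_part (embed g) = g" by (simp add: own_part_def embed_def vec_eq_iff)
  then show ?thesis by (simp add: norm_eq_sqrt_inner inner_Sc_embed)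
qed

lemma own_part_kron_one: "own_part (kron_vector 1 a) = a"
  by (simp add: own_part_def kron_vector_def vec_eq_iff)

lemma embed_add: "embed (g + h) = embed g + embed h"
  by (simp add: embed_def vec_eq_iff)

lemma norm_Sc_mix: "norm (Sc (mix z)) \<le> norm (Sc z)"
proof (rule power2_le_imp_le)
  show "(norm (Sc (mix z)))\<^sup>2 \<le> (norm (Sc z))\<^sup>2"
    unfolding norm_Sc_columns column_mix by (intro sum_mono power_mono W_nonexpansive) auto
qed simp

definition "q_min = Min (range (($) q))"

lemma q_min_le: "q_min \<le> q $ i"
  unfolding q_min_def by (rule Min_le) auto

lemma q_min_norm: "q_min * (norm a)\<^sup>2 \<le> (norm (sb a))\<^sup>2"
proof -
  have "q_min * (norm a)\<^sup>2 = (\<Sum>c\<in>UNIV. q_min * (a $ c)\<^sup>2)"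
    by (simp add: norm_vec_squared sum_distrib_left)
  also have "\<dots> \<le> (norm (sb a))\<^sup>2"
    unfolding norm_weigh_squared[OF q_nonneg] by (intro sum_mono mult_right_mono q_min_le) auto
  finally show ?thesis .
qed

text \<open>Both constants are tested on a coordinate vector: monotonicity bounds the product from
  below, Cauchy-Schwarz and the Lipschitz bound from above. The upper left entry of
  \<open>M \<alpha>\<close> is then at least \<open>(1 - \<alpha> * l)\<^sup>2\<close>, so the trace
  is nonnegative.\<close>

lemma m_q_min_le_l: "m * q_min \<le> l"
proof -
  obtain c :: 'c where True by blast
  define a where "a = (axis c 1 :: real^'c)"
  have a: "norm a = 1" by (simp add: a_def)
  have sa: "(norm (sb a))\<^sup>2 = q $ own c"
    unfolding norm_weigh_squared[OF q_nonneg] a_def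
    by (simp add: axis_def if_distrib if_distribR cong: if_cong)
  then have sa1: "norm (sb a) \<le> 1"
    using q_le_1[of "own c"] power2_le_imp_le[of "norm (sb a)" 1] by simp
  have "m * q_min \<le> m * (norm (sb a))\<^sup>2"
    unfolding sa using m q_min_le by (intro mult_left_mono) auto
  also have "\<dots> \<le> sb (EF (kron_vector 1 a) - EF (kron_vector 1 0)) \<bullet> sb a"
    using monotone_EF[of a 0] by simp
  also have "\<dots> \<le> norm (sb (EF (kron_vector 1 a) - EF (kron_vector 1 0))) * norm (sb a)"
    by (rule norm_cauchy_schwarz)
  also have "\<dots> \<le> (l * 1) * 1"
    using lipschitz_EF[of "kron_vector 1 a" "kron_vector 1 0"] l sa1 a
    by (intro mult_mono) (auto simp: kron_one_diff norm_Sc_kron_one)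
  finally show ?thesis by simp
qed

abbreviation "M \<alpha> \<equiv> contraction_matrix \<alpha> m l \<sigma> q_min"

lemma M_norm:
  assumes "0 < \<alpha>"
  shows "lambda_max (M \<alpha>) = onorm (\<lambda>v. M \<alpha> *v v)" and "0 \<le> lambda_max (M \<alpha>)"
proof -
  have "\<alpha> * (m * q_min) \<le> \<alpha> * l" using m_q_min_le_l assms by (intro mult_left_mono) auto
  moreover have "0 \<le> (1 - \<alpha> * l)\<^sup>2" by simp
  ultimately have "0 \<le> 1 - 2 * \<alpha> * m * q_min + \<alpha>\<^sup>2 * l\<^sup>2"
    by (simp add: power2_eq_square algebra_simps)
  moreover have "0 \<le> (1 + 2 * \<alpha> * l + \<alpha>\<^sup>2 * l\<^sup>2) * \<sigma>\<^sup>2" using assms l by simp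
  ultimately have "0 \<le> M \<alpha> $ 1 $ 1 + M \<alpha> $ 2 $ 2" by simp
  from onorm_symmetric_2[OF transpose_contraction_matrix this]
  show "lambda_max (M \<alpha>) = onorm (\<lambda>v. M \<alpha> *v v)" "0 \<le> lambda_max (M \<alpha>)" by auto
qed

lemma \<sigma>_less_1:
  assumes "0 < \<alpha>" "lambda_max (M \<alpha>) < 1"
  shows "\<sigma> < 1"
proof -
  have "\<sigma>\<^sup>2 \<le> (1 + 2 * \<alpha> * l + \<alpha>\<^sup>2 * l\<^sup>2) * \<sigma>\<^sup>2"
    using assms l by (intro mult_le_cancel_right1[THEN iffD2]) auto
  also have "\<dots> \<le> lambda_max (M \<alpha>)"
    using contraction_matrix_form_le[of \<alpha> m q_min l 0 \<sigma> 1] by simp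
  finally have "\<sigma>\<^sup>2 < 1\<^sup>2" using assms(2) by simp
  then show ?thesis by (rule power_less_imp_less_base) simp
qed

text \<open>One step of the iteration with the exact weights \<open>q\<close> in place of their estimates.\<close>

lemma ideal_step:
  fixes xs :: "real^'c"
  assumes "0 < \<alpha>"
  shows "norm (Sc (mix y - kron_vector 1 xs - \<alpha> *\<^sub>R embed (EF (mix y) - EF (kron_vector 1 xs))))
    \<le> sqrt (lambda_max (M \<alpha>)) * norm (Sc (y - kron_vector 1 xs))"
proof -
  let ?X = "kron_vector 1 xs :: real^('i \<times> 'c)"
  define d where "d = y - ?X"
  define a where "a = average d"
  define u where "u = (kron_vector 1 a :: real^('i \<times> 'c))"
  define v where "v = mix d - u"
  \<comment> \<open>The intermediate point \<open>?X + u\<close> repeats the average of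
    \<open>y\<close>. So \<open>g\<close> compares two consensus stacks, where monotonicity is
    available, and \<open>h\<close> is due to disagreement alone.\<close>
  define g where "g = embed (EF (?X + u) - EF ?X)"
  define h where "h = embed (EF (mix y) - EF (?X + u))"
  have md: "mix y - ?X = u + v" by (simp add: v_def d_def mix_diff mix_kron_one)
  then have myv: "mix y - (?X + u) = v" by (simp add: algebra_simps)
  have Xu: "?X + u = kron_vector 1 (xs + a)" by (simp add: u_def kron_vector_def vec_eq_iff distrib_left)
  have gh: "embed (EF (mix y) - EF ?X) = g + h" by (simp add: g_def h_def flip: embed_add)
  note dec = mix_disagreement[of d, folded a_def, folded u_def, folded v_def]
    consensus_orthogonal[of d, folded a_def, folded u_def, folded v_def]
    consensus_pythagoras[of d, folded a_def, folded u_def]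
  have 1: "norm (Sc g) \<le> l * norm (Sc u)"
    using lipschitz_EF[of "?X + u" ?X] by (simp add: g_def norm_Sc_embed)
  have 2: "norm (Sc h) \<le> l * norm (Sc v)"
    using lipschitz_EF[of "mix y" "?X + u"] unfolding h_def norm_Sc_embed myv .
  have 3: "norm (Sc g + Sc h) \<le> l * norm (Sc u + Sc v)"
    using lipschitz_EF[of "mix y" ?X] unfolding md norm_Sc_embed[symmetric] gh weigh_add .
  \<comment> \<open>Since q sums to 1, \<open>Sc u\<close> has norm |a|, while monotonicity controls
    \<open>norm (sb a)\<close>; the comparison costs the factor \<open>q_min\<close>.\<close>
  have "m * (q_min * (norm (Sc u))\<^sup>2) \<le> m * (norm (sb a))\<^sup>2"
    using m q_min_norm[of a] by (intro mult_left_mono) (auto simp: u_def norm_Sc_kron_one)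
  also have "\<dots> \<le> Sc g \<bullet> Sc u"
    using monotone_EF[of "xs + a" xs, folded Xu]
    by (simp add: g_def inner_Sc_embed own_part_kron_one[of a, folded u_def])
  finally have 4: "(m * q_min) * (norm (Sc u))\<^sup>2 \<le> Sc g \<bullet> Sc u" by (simp add: mult.assoc)
  let ?A = "1 - 2 * \<alpha> * m * q_min + \<alpha>^2 * l^2" and ?D = "1 + 2 * \<alpha> * l + \<alpha>^2 * l^2"
  let ?s = "\<sigma> * norm (Sc (d - u))"
  have "(norm (Sc (u + v - \<alpha> *\<^sub>R (g + h))))\<^sup>2
      \<le> ?A * (norm (Sc u))\<^sup>2 + 4 * \<alpha> * l * norm (Sc u) * norm (Sc v) + ?D * (norm (Sc v))\<^sup>2"
    using gradient_step_bound[OF dec(2) _ 1 2 3 4, of \<alpha>] assms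
    by (simp add: weigh_add weigh_diff weigh_scaleR mult.assoc)
  also have "\<dots> \<le> ?A * (norm (Sc u))\<^sup>2 + 4 * \<alpha> * l * norm (Sc u) * ?s + ?D * ?s\<^sup>2"
  proof (intro add_mono order_refl)
    show "4 * \<alpha> * l * norm (Sc u) * norm (Sc v) \<le> 4 * \<alpha> * l * norm (Sc u) * ?s"
      using assms l by (intro mult_left_mono dec(1)) simp
    show "?D * (norm (Sc v))\<^sup>2 \<le> ?D * ?s\<^sup>2"
      using assms l by (intro mult_left_mono power_mono dec(1)) simp_all
  qed
  also have "\<dots> \<le> lambda_max (M \<alpha>) * ((norm (Sc u))\<^sup>2 + (norm (Sc (d - u)))\<^sup>2)"
    by (rule contraction_matrix_form_le)
  also have "\<dots> = (sqrt (lambda_max (M \<alpha>)) * norm (Sc d))\<^sup>2"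
    using M_norm(2)[OF assms] by (simp add: dec(3) power_mult_distrib)
  finally show ?thesis
    unfolding md gh d_def[symmetric] by (rule power2_le_imp_le) (simp add: M_norm(2)[OF assms])
qed

lemma norm_Sc_estimates: "(norm (Sc z))\<^sup>2 = (\<Sum>i\<in>UNIV. q $ i * (norm (estimate z i))\<^sup>2)"
proof -
  have "(norm (Sc z))\<^sup>2 = (\<Sum>(i, c)\<in>UNIV. q $ i * (z $ (i, c))\<^sup>2)"
    by (simp add: norm_weigh_squared q_nonneg case_prod_unfold)
  also have "\<dots> = (\<Sum>i\<in>UNIV. \<Sum>c\<in>UNIV. q $ i * (z $ (i, c))\<^sup>2)"
    by (simp add: sum.cartesian_product)
  finally show ?thesis
    by (simp add: norm_vec_squared estimate_def sum_distrib_left)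
qed

text \<open>In agent i's own block both \<open>x'\<close> and \<open>xs\<close> are projections onto
  the same set, the latter since an equilibrium is a fixed point for the step \<open>s i\<close>,
  and projections do not increase distances. The other blocks are copied, and \<open>embed\<close>
  vanishes there.\<close>

lemma projected_step:
  assumes nash: "nash_equilibrium own \<Omega> J xs" and "\<And>i. 0 \<le> s i"
    and own_block: "\<And>i. bl i (estimate x' i)
      = closest_point (\<Omega> i) (bl i (estimate y i) - s i *\<^sub>R G i (estimate y i))"
    and other_block: "\<And>i j. j \<noteq> i \<Longrightarrow> bl j (estimate x' i) = bl j (estimate y i)"
  shows "norm (Sc (x' - kron_vector 1 xs))
    \<le> norm (Sc (y - kron_vector 1 xs - embed (\<chi> c. s (own c) *
        (ext_pseudo_grad own J y - ext_pseudo_grad own J (kron_vector 1 xs)) $ c)))"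
    (is "_ \<le> norm (Sc ?z)")
proof (rule power2_le_imp_le)
  have est: "norm (estimate (x' - kron_vector 1 xs) i) \<le> norm (estimate ?z i)" for i
  proof -
    have d: "estimate (x' - kron_vector 1 xs) i = estimate x' i - xs"
      by (simp add: estimate_def kron_vector_def vec_eq_iff)
    have "norm (bl j (estimate x' i - xs)) \<le> norm (bl j (estimate ?z i))" for j
    proof (cases "j = i")
      case True
      let ?y = "bl i (estimate y i) - s i *\<^sub>R G i (estimate y i)"
      let ?x = "bl i xs - s i *\<^sub>R G i xs"
      have "bl i (estimate x' i - xs) = closest_point (\<Omega> i) ?y - closest_point (\<Omega> i) ?x"
        using nash_equilibrium_projection[OF nash assms(2)]
        by (simp add: linear_diff[OF linear_block] own_block)
      moreover have "bl i (estimate ?z i) = ?y - ?x"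
        using partial_grad_block_space
        by (auto simp: vec_eq_iff estimate_def embed_def kron_vector_def ext_pseudo_grad_def algebra_simps)
      moreover have "dist (closest_point (\<Omega> i) ?y) (closest_point (\<Omega> i) ?x) \<le> dist ?y ?x"
        using strategy_sets by (intro closest_point_lipschitz) auto
      ultimately show ?thesis using True by (simp add: dist_norm)
    next
      case False
      have "bl j (estimate ?z i) = bl j (estimate y i) - bl j xs"
        using False by (auto simp: vec_eq_iff estimate_def embed_def kron_vector_def)
      then show ?thesis using other_block[OF False] by (simp add: linear_diff[OF linear_block])
    qed
    then have "(\<Sum>j\<in>UNIV. bl j (estimate x' i - xs) \<bullet> bl j (estimate x' i - xs))
        \<le> (\<Sum>j\<in>UNIV. bl j (estimate ?z i) \<bullet> bl j (estimate ?z i))"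
      by (intro sum_mono) (simp add: norm_le)
    then show ?thesis unfolding d norm_le by (simp flip: inner_blocks)
  qed
  show "(norm (Sc (x' - kron_vector 1 xs)))\<^sup>2 \<le> (norm (Sc ?z))\<^sup>2"
    unfolding norm_Sc_estimates by (intro sum_mono mult_left_mono power_mono est q_nonneg) auto
qed simp

text \<open>The step \<open>s i\<close> equals \<open>1 / q $ i\<close> times
  \<open>1 + (q $ i * s i - 1)\<close>. The 1 yields the ideal step; the rest is a gradient
  difference scaled by at most \<open>e\<close>, which the Lipschitz bound and
  \<open>norm_Sc_mix\<close> control.\<close>

lemma perturbed_step:
  assumes nash: "nash_equilibrium own \<Omega> J xs" and \<alpha>: "0 < \<alpha>"
    and s: "\<And>i. 0 \<le> s i" "\<And>i. \<bar>q $ i * s i - 1\<bar> \<le> e"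
    and own_block: "\<And>i. bl i (estimate x' i)
      = closest_point (\<Omega> i) (bl i (estimate (mix x) i) - (\<alpha> * s i) *\<^sub>R G i (estimate (mix x) i))"
    and other_block: "\<And>i j. j \<noteq> i \<Longrightarrow> bl j (estimate x' i) = bl j (estimate (mix x) i)"
  shows "norm (Sc (x' - kron_vector 1 xs))
    \<le> (sqrt (lambda_max (M \<alpha>)) + \<alpha> * l * e) * norm (Sc (x - kron_vector 1 xs))"
proof -
  let ?X = "kron_vector 1 xs :: real^('i \<times> 'c)"
  define D where "D = EF (mix x) - EF ?X"
  define p where "p = (\<chi> c. (q $ own c * s (own c) - 1) * D $ c)"
  have e: "0 \<le> e" using s(2) abs_ge_zero order_trans by metis
  have qn: "q $ i \<noteq> 0" for i using q_pos[of i] by simp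
  have "norm (Sc (x' - ?X)) \<le> norm (Sc (mix x - ?X - embed (\<chi> c. \<alpha> * s (own c) *
        (ext_pseudo_grad own J (mix x) - ext_pseudo_grad own J ?X) $ c)))"
    using projected_step[OF nash _ own_block other_block] \<alpha> s(1) by simp
  also have "mix x - ?X - embed (\<chi> c. \<alpha> * s (own c) *
        (ext_pseudo_grad own J (mix x) - ext_pseudo_grad own J ?X) $ c)
      = (mix x - ?X - \<alpha> *\<^sub>R embed D) - \<alpha> *\<^sub>R embed p"
    using qn by (auto simp: vec_eq_iff embed_def p_def D_def EF_diff field_simps)
  also have "norm (Sc \<dots>) \<le> norm (Sc (mix x - ?X - \<alpha> *\<^sub>R embed D)) + \<alpha> * norm (sb p)"
    unfolding weigh_diff[of _ "mix x - ?X - \<alpha> *\<^sub>R embed D"]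
    using norm_triangle_ineq4[of "Sc (mix x - ?X - \<alpha> *\<^sub>R embed D)" "Sc (\<alpha> *\<^sub>R embed p)"] \<alpha>
    by (simp add: weigh_scaleR norm_Sc_embed)
  finally have split: "norm (Sc (x' - ?X)) \<le> norm (Sc (mix x - ?X - \<alpha> *\<^sub>R embed D)) + \<alpha> * norm (sb p)" .
  have p: "norm (sb p) \<le> e * norm (sb D)"
  proof (rule power2_le_imp_le)
    have "(norm (sb p))\<^sup>2 \<le> (\<Sum>c\<in>UNIV. q $ own c * (e\<^sup>2 * (D $ c)\<^sup>2))"
      unfolding norm_weigh_squared[OF q_nonneg] p_def
      using s(2) e by (intro sum_mono mult_left_mono q_nonneg)
        (auto simp: power_mult_distrib intro!: mult_right_mono abs_le_square_iff[THEN iffD1])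
    also have "\<dots> = (e * norm (sb D))\<^sup>2"
      unfolding power_mult_distrib norm_weigh_squared[OF q_nonneg] by (simp add: sum_distrib_left mult_ac)
    finally show "(norm (sb p))\<^sup>2 \<le> (e * norm (sb D))\<^sup>2" .
  qed (use e in simp)
  have D: "norm (sb D) \<le> l * norm (Sc (x - ?X))"
  proof -
    have "norm (sb D) \<le> l * norm (Sc (mix (x - ?X)))"
      unfolding D_def mix_diff mix_kron_one by (rule lipschitz_EF)
    also have "\<dots> \<le> l * norm (Sc (x - ?X))" using l by (intro mult_left_mono norm_Sc_mix) auto
    finally show ?thesis .
  qed
  have "\<alpha> * norm (sb p) \<le> \<alpha> * (e * (l * norm (Sc (x - ?X))))"
    using \<alpha> by (intro mult_left_mono order_trans[OF p mult_left_mono[OF D e]]) simp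
  moreover have "norm (Sc (mix x - ?X - \<alpha> *\<^sub>R embed D)) \<le> sqrt (lambda_max (M \<alpha>)) * norm (Sc (x - ?X))"
    unfolding D_def by (rule ideal_step[OF \<alpha>])
  ultimately show ?thesis using split by (simp add: algebra_simps)
qed

lemma mixed_estimate_eq:
  assumes "\<And>i j. (i, j) \<notin> E \<Longrightarrow> W $ i $ j = 0"
  shows "mixed_estimate E W x i = estimate (mix x) i"
proof -
  have "mixed_estimate E W x i = (\<Sum>j\<in>UNIV. W $ i $ j *\<^sub>R estimate x j)"
    unfolding mixed_estimate_def using assms by (intro sum.mono_neutral_left) auto
  then show ?thesis by (simp add: vec_eq_iff mix_def estimate_def)
qed

theorem algorithm_converges:
  assumes E: "\<And>i j. (i, j) \<notin> E \<Longrightarrow> W $ i $ j = 0"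
    and alg: "generated_by_algorithm own \<Omega> J E W (\<lambda>k. \<alpha>) x qh"
    and nash: "nash_equilibrium own \<Omega> J xs" and \<alpha>: "0 < \<alpha>" and \<rho>: "lambda_max (M \<alpha>) < 1"
  shows "x \<longlonglongrightarrow> kron_vector 1 xs"
    and "\<And>\<epsilon>. 0 < \<epsilon> \<Longrightarrow> \<exists>K>0. \<forall>k. norm (Sc (x k - kron_vector 1 xs))
      \<le> K * (sqrt (lambda_max (M \<alpha>)) + \<epsilon>) ^ k * norm (Sc (x 0 - kron_vector 1 xs))"
proof -
  let ?r = "sqrt (lambda_max (M \<alpha>))"
  let ?n = "\<lambda>k. norm (Sc (x k - kron_vector 1 xs))"
  have "mixed_estimate E W z i = estimate (mix z) i" for z :: "real^('i \<times> 'c)" and i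
    using E by (rule mixed_estimate_eq)
  note gen = alg[unfolded generated_by_algorithm_def this]
  \<comment> \<open>Transposing the estimates: for fixed \<open>j\<close>, the vector of the agents'
    guesses of \<open>q $ j\<close> evolves by \<open>W\<close>.\<close>
  define p where "p j k = (\<chi> i. qh k i $ j)" for j k
  have p0: "p j 0 = axis j 1" for j
    using gen by (auto simp: p_def vec_eq_iff axis_def)
  have pS: "p j (Suc k) = W *v p j k" for j k
  proof -
    have "qh (Suc k) i = (\<Sum>j\<in>UNIV. W $ i $ j *\<^sub>R qh k j)" for i
    proof -
      have "qh (Suc k) i = (\<Sum>j\<in>{j. (i, j) \<in> E}. W $ i $ j *\<^sub>R qh k j)" using gen by blast
      also have "\<dots> = (\<Sum>j\<in>UNIV. W $ i $ j *\<^sub>R qh k j)"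
        using E by (intro sum.mono_neutral_left) auto
      finally show ?thesis .
    qed
    then show ?thesis by (simp add: p_def vec_eq_iff matrix_vector_mult_def)
  qed
  have lim: "(\<lambda>k. qh k i $ i) \<longlonglongrightarrow> q $ i" for i
    using consensus_limit[OF \<sigma>_less_1[OF \<alpha> \<rho>], of "p i" i i] p0 pS by (simp add: p_def)
  have "0 \<le> p j k $ i" for i j k
  proof (induction k arbitrary: i)
    case 0 show ?case by (simp add: p0 axis_def)
  next
    case (Suc k)
    then show ?case by (simp add: pS matrix_vector_mult_def sum_nonneg W_nonneg)
  qed
  \<comment> \<open>Nonnegativity suffices for the step sizes, since \<open>inverse 0 = 0\<close>;
    positivity matters only in the limit, where it is that of q.\<close>
  from this[of i _ i for i] have qh_nonneg: "0 \<le> qh k i $ i" for k i by (simp add: p_def)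
  define e where "e k = (\<Sum>i\<in>UNIV. \<bar>q $ i * inverse (qh k i $ i) - 1\<bar>)" for k
  have e0: "0 \<le> e k" for k unfolding e_def by (simp add: sum_nonneg)
  have "e \<longlonglongrightarrow> (\<Sum>i\<in>UNIV. \<bar>q $ i * inverse (q $ i) - 1\<bar>)"
    unfolding e_def using q_pos by (intro tendsto_intros lim) (simp add: less_imp_neq[THEN not_sym])
  also have "(\<Sum>i\<in>UNIV. \<bar>q $ i * inverse (q $ i) - 1\<bar>) = 0"
    using q_pos by (intro sum.neutral) (simp add: less_imp_neq[THEN not_sym])
  finally have e: "e \<longlonglongrightarrow> 0" .
  have step: "?n (Suc k) \<le> (?r + \<alpha> * l * e k) * ?n k" for k
  proof (rule perturbed_step[OF nash \<alpha>, where s = "\<lambda>i. inverse (qh k i $ i)"])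
    show "0 \<le> inverse (qh k i $ i)" for i using qh_nonneg by simp
    show "\<bar>q $ i * inverse (qh k i $ i) - 1\<bar> \<le> e k" for i
      unfolding e_def by (rule member_le_sum[of i UNIV "\<lambda>i. \<bar>q $ i * inverse (qh k i $ i) - 1\<bar>"]) auto
  qed (use gen in auto)
  show rate: "\<exists>K>0. \<forall>k. ?n k \<le> K * (?r + \<epsilon>) ^ k * ?n 0" if "0 < \<epsilon>" for \<epsilon>
  proof (rule perturbed_linear_rate[where e = "\<lambda>k. \<alpha> * l * e k" and a = "?n"])
    show "(\<lambda>k. \<alpha> * l * e k) \<longlonglongrightarrow> 0" using tendsto_mult_right_zero[OF e] by blast
  qed (use that \<alpha> l e0 M_norm(2)[OF \<alpha>] step in auto)
  \<comment> \<open>The midpoint between \<open>?r\<close> and 1 corresponds to the choice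
    \<epsilon> = \<open>(1 - ?r) / 2\<close>, a rate still below 1; convergence follows from
    it.\<close>
  define b where "b = (?r + 1) / 2"
  have "?r < 1" using \<rho> by simp
  then have b: "0 \<le> b" "b < 1" "0 < (1 - ?r) / 2" "?r + (1 - ?r) / 2 = b"
    using M_norm(2)[OF \<alpha>] real_sqrt_ge_zero[OF M_norm(2)[OF \<alpha>]] by (auto simp: b_def field_simps)
  from rate[OF b(3)] obtain K where K: "\<And>k. ?n k \<le> K * b ^ k * ?n 0" unfolding b(4) by blast
  have "(\<lambda>k. K * b ^ k * ?n 0) \<longlonglongrightarrow> 0"
    using b(1,2) by (intro tendsto_mult_left_zero tendsto_mult_right_zero LIMSEQ_realpow_zero)
  then have "?n \<longlonglongrightarrow> 0"
    by (rule Lim_null_comparison[rotated]) (simp add: K)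
  then have "(\<lambda>k. x k - kron_vector 1 xs) \<longlonglongrightarrow> 0"
    by (rule tendsto_zero_weigh[rotated]) (rule q_pos)
  then show "x \<longlonglongrightarrow> kron_vector 1 xs" by (simp add: LIM_zero_iff)
qed

end

theorem theorem2:
  fixes own :: "'c::finite \<Rightarrow> 'i::finite"
    and \<Omega> :: "'i \<Rightarrow> (real^'c) set"
    and J :: "'i \<Rightarrow> real^'c \<Rightarrow> real"
    and \<mu> l\<^sub>0 \<mu>b lb \<sigma>b \<alpha> \<rho> :: real
    and E :: "('i \<times> 'i) set"
    and W Q :: "real^'i^'i"
    and q :: "real^'i"
    and Qb :: "real^'c^'c"
    and QQ :: "real^('i \<times> 'c)^('i \<times> 'c)"
    and x :: "nat \<Rightarrow> real^('i \<times> 'c)"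
    and qh :: "nat \<Rightarrow> 'i \<Rightarrow> real^'i"
  assumes agents: "CARD('i) \<ge> 2"
    and strategy_sets:
      "\<And>i. \<Omega> i \<subseteq> block_space own i \<and> \<Omega> i \<noteq> {} \<and> closed (\<Omega> i) \<and> convex (\<Omega> i)"
    and cost_continuous: "\<And>i. continuous_on UNIV (J i)"
    and cost_convex: "\<And>i z. convex_on (block_space own i) (\<lambda>y. J i (replace_block own i y z))"
    and cost_C1: "\<And>i z. cont_differentiable (\<lambda>y. J i (replace_block own i y z))"
    and strongly_monotone: "\<mu> > 0"
      "\<And>y z. (pseudo_grad own J y - pseudo_grad own J z) \<bullet> (y - z) \<ge> \<mu> * (norm (y - z))\<^sup>2"
    and Lipschitz: "l\<^sub>0 > 0" "l\<^sub>0-lipschitz_on UNIV (pseudo_grad own J)"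
    and strongly_connected: "\<And>i j. (i, j) \<in> E\<^sup>*"
    and weights: "\<And>i j. (i, j) \<in> E \<Longrightarrow> W $ i $ j > 0" "\<And>i j. (i, j) \<notin> E \<Longrightarrow> W $ i $ j = 0"
      "\<And>i. W $ i $ i > 0"
    and row_stochastic: "W *v 1 = 1"
    and left_PF: "\<And>i. q $ i > 0" "q v* W = q" "1 \<bullet> q = 1"
    and Q_def: "Q = diag_matrix (\<lambda>i. q $ i)"
    and Qb_def: "Qb = diag_matrix (\<lambda>c. q $ own c)"
    and QQ_def: "QQ = kron_matrix Q (mat 1 :: real^'c^'c)"
    and \<sigma>b_def: "\<sigma>b = singular_value (CARD('i) - 1)
        (diag_matrix (\<lambda>i. sqrt (q $ i)) ** W ** diag_matrix (\<lambda>i. 1 / sqrt (q $ i)))"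
    and \<mu>b: "\<mu>b > 0"
      "\<And>y z. inner_wrt Qb
          (matrix_inv Qb *v pseudo_grad own J y - matrix_inv Qb *v pseudo_grad own J z) (y - z)
        \<ge> \<mu>b * (norm_wrt Qb (y - z))\<^sup>2"
    and lb: "lb > 0"
      "\<And>y z. norm_wrt Qb
          (matrix_inv Qb *v ext_pseudo_grad own J y - matrix_inv Qb *v ext_pseudo_grad own J z)
        \<le> lb * norm_wrt QQ (y - z)"
    and step: "\<alpha> > 0"
    and \<rho>_def: "\<rho> = lambda_max (contraction_matrix \<alpha> \<mu>b lb \<sigma>b (lambda_min Q))"
    and \<rho>_less_1: "\<rho> < 1"
    and algorithm: "generated_by_algorithm own \<Omega> J E W (\<lambda>k. \<alpha>) x qh"
  shows "\<rho> = onorm (\<lambda>v. contraction_matrix \<alpha> \<mu>b lb \<sigma>b (lambda_min Q) *v v) \<and>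
    (\<exists>xs. {z. nash_equilibrium own \<Omega> J z} = {xs} \<and>
      x \<longlonglongrightarrow> kron_vector 1 xs \<and>
      (\<forall>\<epsilon>>0. \<exists>K>0. \<forall>k.
        norm_wrt QQ (x k - kron_vector 1 xs)
          \<le> K * (sqrt \<rho> + \<epsilon>) ^ k * norm_wrt QQ (x 0 - kron_vector 1 xs)))"
proof -
  have q0: "0 \<le> q $ i" "q $ i \<noteq> 0" for i using left_PF(1)[of i] by auto
  have q0': "0 \<le> q $ own c" "q $ own c \<noteq> 0" "0 \<le> q $ fst r" for c and r :: "'i \<times> 'c"
    using q0 by auto
  have QQ: "QQ = diag_matrix (\<lambda>r. q $ fst r)"
    unfolding QQ_def Q_def by (rule kron_matrix_diag_one)
  have norm_QQ: "norm_wrt QQ z = norm (weigh (\<lambda>r. q $ fst r) z)" for z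
    unfolding QQ by (rule norm_wrt_diag_matrix) (rule q0')
  have norm_Qb: "norm_wrt Qb z = norm (weigh (\<lambda>c. q $ own c) z)" for z
    unfolding Qb_def by (rule norm_wrt_diag_matrix) (rule q0')
  have inner_Qb: "inner_wrt Qb y z = weigh (\<lambda>c. q $ own c) y \<bullet> weigh (\<lambda>c. q $ own c) z" for y z
    unfolding Qb_def by (rule inner_wrt_diag_matrix) (rule q0')
  have inv_Qb: "matrix_inv Qb *v y - matrix_inv Qb *v z = (\<chi> c. (y - z) $ c / q $ own c)" for y z
    using q0'(2) by (simp add: Qb_def vec_eq_iff matrix_inv_diag_matrix diff_divide_distrib)
  interpret seeking W q \<sigma>b own \<Omega> J \<mu>b lb
  proof
    show "0 \<le> W $ i $ j" for i j
      using weights(1,2)[of i j] by (cases "(i, j) \<in> E") auto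
    show "\<mu>b * (norm (weigh (\<lambda>c. q $ own c) (y - z)))\<^sup>2
      \<le> weigh (\<lambda>c. q $ own c) (\<chi> c. (pseudo_grad own J y - pseudo_grad own J z) $ c / q $ own c)
        \<bullet> weigh (\<lambda>c. q $ own c) (y - z)" for y z
      using \<mu>b(2)[of y z] unfolding inv_Qb inner_Qb norm_Qb .
    show "norm (weigh (\<lambda>c. q $ own c)
        (\<chi> c. (ext_pseudo_grad own J y - ext_pseudo_grad own J z) $ c / q $ own c))
      \<le> lb * norm (weigh (\<lambda>r. q $ fst r) (y - z))" for y z
      using lb(2)[of y z] unfolding inv_Qb norm_Qb norm_QQ .
  qed fact+
  have "lambda_min Q = q_min"
    unfolding Q_def q_min_def by (rule lambda_min_diag_matrix)
  note \<rho> = \<rho>_def[unfolded this]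
  obtain xs where nash: "nash_equilibrium own \<Omega> J xs"
    and unique: "\<And>z. nash_equilibrium own \<Omega> J z \<Longrightarrow> z = xs"
    using nash_equilibrium_exists_unique[OF strongly_monotone Lipschitz] by blast
  note conv = algorithm_converges[OF weights(2) algorithm nash step \<rho>_less_1[unfolded \<rho>], folded \<rho>]
  have "{z. nash_equilibrium own \<Omega> J z} = {xs}" using nash unique by blast
  then show ?thesis
    unfolding \<open>lambda_min Q = q_min\<close> norm_QQ
    using conv M_norm(1)[OF step, folded \<rho>] by blast
qed

end
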